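(* Let $$g_P^+=\psi_P^++R_2\psi_P^--q_PR_1\psi_S^-,\qquad g_S^+=\psi_S^++q_S\widetilde R_1\psi_P^-+\widetilde R_2\psi_S^-$$ be the reflected Jost solutions. Then the Green's function (kernel of the resolvent) of the Rayleigh operator on the half line $Z<0$ subject to the traction-free boundary condition at $Z=0$ is $$G(Z,Z',\xi)=\frac{1}{2i\omega^2}\begin{cases}\dfrac1{q_P}\psi_P^-(Z)\,(g_P^+(Z'))^{T}+\dfrac1{q_S}\psi_S^-(Z)\,(g_S^+(Z'))^{T},& Z<Z'<0,\\[2mm] \dfrac1{q_P}g_P^+(Z)\,(\psi_P^-(Z'))^{T}+\dfrac1{q_S}g_S^+(Z)\,(\psi_S^-(Z'))^{T},& Z'<Z<0.\end{cases}$$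
   Context: Setting. Fix $\omega>0$, $H>0$ and real functions $\lambda,\mu\in C^3((-\infty,0])$ with $\mu\ge\alpha_0>0$, $2\mu+3\lambda\ge\beta_0>0$ for some constants $\alpha_0,\beta_0$, and $\lambda(Z)=\lambda_0$, $\mu(Z)=\mu_0$ (constants) for $Z<-H$. Put $\sigma_0=\lambda_0+2\mu_0$. For $\xi\in\mathbb{C}$ the Rayleigh operator acts on $\psi=(\psi_1,\psi_2)^{T}$, $Z<0$, by $$\mathcal{L}_\xi\psi=(P\psi')'+\xi\,(N\psi'-(N^{T}\psi)')+(\omega^2 I-\xi^2M)\psi,$$ with $P=\begin{pmatrix}\mu&0\\0&\lambda+2\mu\end{pmatrix}$, $M=\begin{pmatrix}\lambda+2\mu&0\\0&\mu\end{pmatrix}$, $N=\begin{pmatrix}0&-\lambda\\ \mu&0\end{pmatrix}$, $'=d/dZ$. Quasimomenta: $q_P^2=\omega^2/\sigma_0-\xi^2$, $q_S^2=\omega^2/\mu_0-\xi^2$; the physical sheet is the one where $\operatorname{Im}q_P>0$ and $\operatorname{Im}q_S>0$. Jost solutions. $\psi_P^\pm,\psi_S^\pm$ are the solutions of $\mathcal{L}_\xi\psi=0$ which for $Z\le -H$ equal $$\psi_P^\pm=\begin{pmatrix}-\xi\\ \pm i q_P\end{pmatrix}e^{\pm iZq_P},\qquad \psi_S^\pm=\begin{pmatrix}\pm i q_S\\ -\xi\end{pmatrix}e^{\pm iZq_S}.$$ Boundary tractions: $\hat a(\psi)=i\big(\lambda(0^-)\xi\psi_1(0^-)+(\lambda(0^-)+2\mu(0^-))\psi_2'(0^-)\big)$,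 $\hat b(\psi)=-\xi\mu(0^-)\psi_2(0^-)+\mu(0^-)\psi_1'(0^-)$; traction-free means $\hat a(\psi)=\hat b(\psi)=0$. The Rayleigh determinant is $\Delta=\hat a(\psi_P^-)\hat b(\psi_S^-)-\hat a(\psi_S^-)\hat b(\psi_P^-)$. Reflection coefficients. $R_1,R_2,\widetilde R_1,\widetilde R_2$ (functions of $\xi$) are determined, where $\Delta\ne0$ and $q_Pq_S\neq0$, by requiring $\hat a(g_P^+)=\hat b(g_P^+)=0$ and $\hat a(g_S^+)=\hat b(g_S^+)=0$. Green's function: for $\xi$ on the physical sheet with $\Delta(\xi)\neq0$, $G(\cdot,Z',\xi)$ is the $2\times2$ matrix function with $\mathcal{L}_\xi G(\cdot,Z',\xi)=\delta(\cdot-Z')I_2$ on $Z<0$ (so $G$ is continuous across $Z=Z'$ and $P\,\partial_ZG$ jumps by $I_2$ there as $Z$ increases through $Z'$), whose columns are traction-free at $Z=0$ and decay as $Z\to-\infty$. *)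

theory Defs
  imports "HOL-Analysis.Analysis"
begin

text \<open>\<open>C_k_on k S f\<close>: the function \<open>f\<close> is \<open>k\<close> times continuously differentiable on \<open>S\<close>.
  Derivatives are taken within \<open>S\<close>, hence one-sided at a boundary point of an interval.\<close>

definition C_k_on :: "nat \<Rightarrow> real set \<Rightarrow> (real \<Rightarrow> real) \<Rightarrow> bool" where
  "C_k_on k S f \<longleftrightarrow>
     (\<exists>D :: nat \<Rightarrow> real \<Rightarrow> real.
        (\<forall>x\<in>S. D 0 x = f x) \<and>
        (\<forall>m<k. \<forall>x\<in>S. (D m has_real_derivative D (Suc m) x) (at x within S)) \<and>
        continuous_on S (D k))"

text \<open>The Lame parameters \<open>\<lambda>, \<mu>\<close> are called \<open>lam, mu\<close>.\<close>

definition P_mat :: "(real \<Rightarrow> real) \<Rightarrow> (real \<Rightarrow> real) \<Rightarrow> real \<Rightarrow> complex^2^2" where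
  "P_mat lam mu Z = vector [vector [of_real (mu Z), 0],
                            vector [0, of_real (lam Z + 2 * mu Z)]]"

definition M_mat :: "(real \<Rightarrow> real) \<Rightarrow> (real \<Rightarrow> real) \<Rightarrow> real \<Rightarrow> complex^2^2" where
  "M_mat lam mu Z = vector [vector [of_real (lam Z + 2 * mu Z), 0],
                            vector [0, of_real (mu Z)]]"

definition N_mat :: "(real \<Rightarrow> real) \<Rightarrow> (real \<Rightarrow> real) \<Rightarrow> real \<Rightarrow> complex^2^2" where
  "N_mat lam mu Z = vector [vector [0, - of_real (lam Z)],
                            vector [of_real (mu Z), 0]]"

abbreviation ddz :: "(real \<Rightarrow> 'a::real_normed_vector) \<Rightarrow> real \<Rightarrow> 'a" where
  "ddz f Z \<equiv> vector_derivative f (at Z)"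

definition rayleigh_op ::
    "real \<Rightarrow> (real \<Rightarrow> real) \<Rightarrow> (real \<Rightarrow> real) \<Rightarrow> complex \<Rightarrow> (real \<Rightarrow> complex^2) \<Rightarrow> real \<Rightarrow> complex^2" where
  "rayleigh_op \<omega> lam mu \<xi> \<psi> Z =
     ddz (\<lambda>z. P_mat lam mu z *v ddz \<psi> z) Z
     + \<xi> *s (N_mat lam mu Z *v ddz \<psi> Z - ddz (\<lambda>z. transpose (N_mat lam mu z) *v \<psi> z) Z)
     + (of_real (\<omega>\<^sup>2) *s \<psi> Z - \<xi>\<^sup>2 *s (M_mat lam mu Z *v \<psi> Z))"

text \<open>Classical solutions on an open set \<open>S\<close> of negative reals. The differentiability clauses are
  needed because \<open>vector_derivative\<close> is a total function.\<close>

definition rayleigh_solution ::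
    "real \<Rightarrow> (real \<Rightarrow> real) \<Rightarrow> (real \<Rightarrow> real) \<Rightarrow> complex \<Rightarrow> real set \<Rightarrow> (real \<Rightarrow> complex^2) \<Rightarrow> bool" where
  "rayleigh_solution \<omega> lam mu \<xi> S \<psi> \<longleftrightarrow>
     (\<forall>Z\<in>S. \<psi> differentiable (at Z) \<and>
            (\<lambda>z. P_mat lam mu z *v ddz \<psi> z) differentiable (at Z) \<and>
            rayleigh_op \<omega> lam mu \<xi> \<psi> Z = 0)"

text \<open>A point of the physical sheet over \<open>\<xi>\<close> is given together with the values there of the two
  quasimomenta; the sign conditions determine these values.\<close>

definition physical_sheet ::
    "real \<Rightarrow> real \<Rightarrow> real \<Rightarrow> complex \<Rightarrow> complex \<Rightarrow> complex \<Rightarrow> bool" where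
  "physical_sheet \<omega> lam0 mu0 \<xi> qP qS \<longleftrightarrow>
     qP\<^sup>2 = of_real (\<omega>\<^sup>2 / (lam0 + 2 * mu0)) - \<xi>\<^sup>2 \<and>
     qS\<^sup>2 = of_real (\<omega>\<^sup>2 / mu0) - \<xi>\<^sup>2 \<and>
     Im qP > 0 \<and> Im qS > 0"

text \<open>The solution on \<open>Z < 0\<close> that equals \<open>exp (\<kappa> Z) v\<close> for \<open>Z \<le> -H\<close>; the four Jost solutions
  are obtained with \<open>\<kappa> = \<plusminus> \<i> qP\<close> and \<open>\<kappa> = \<plusminus> \<i> qS\<close>.\<close>

definition jost_solution ::
    "real \<Rightarrow> real \<Rightarrow> (real \<Rightarrow> real) \<Rightarrow> (real \<Rightarrow> real) \<Rightarrow> complex \<Rightarrow> complex^2 \<Rightarrow> complex \<Rightarrow>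
     (real \<Rightarrow> complex^2) \<Rightarrow> bool" where
  "jost_solution \<omega> H lam mu \<xi> v \<kappa> \<psi> \<longleftrightarrow>
     rayleigh_solution \<omega> lam mu \<xi> {..<0} \<psi> \<and>
     (\<forall>Z\<le>-H. \<psi> Z = exp (\<kappa> * of_real Z) *s v)"

text \<open>The value at \<open>0\<^sup>-\<close>.\<close>

abbreviation at0m :: "(real \<Rightarrow> 'a::t2_space) \<Rightarrow> 'a" where
  "at0m f \<equiv> Lim (at_left 0) f"

definition a_hat ::
    "(real \<Rightarrow> real) \<Rightarrow> (real \<Rightarrow> real) \<Rightarrow> complex \<Rightarrow> (real \<Rightarrow> complex^2) \<Rightarrow> complex" where
  "a_hat lam mu \<xi> \<psi> =
     \<i> * (of_real (at0m lam) * \<xi> * at0m (\<lambda>Z. \<psi> Z $ 1)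
          + of_real (at0m lam + 2 * at0m mu) * at0m (\<lambda>Z. ddz \<psi> Z $ 2))"

definition b_hat ::
    "(real \<Rightarrow> real) \<Rightarrow> (real \<Rightarrow> real) \<Rightarrow> complex \<Rightarrow> (real \<Rightarrow> complex^2) \<Rightarrow> complex" where
  "b_hat lam mu \<xi> \<psi> =
     - \<xi> * of_real (at0m mu) * at0m (\<lambda>Z. \<psi> Z $ 2)
     + of_real (at0m mu) * at0m (\<lambda>Z. ddz \<psi> Z $ 1)"

definition traction_free ::
    "(real \<Rightarrow> real) \<Rightarrow> (real \<Rightarrow> real) \<Rightarrow> complex \<Rightarrow> (real \<Rightarrow> complex^2) \<Rightarrow> bool" where
  "traction_free lam mu \<xi> \<psi> \<longleftrightarrow> a_hat lam mu \<xi> \<psi> = 0 \<and> b_hat lam mu \<xi> \<psi> = 0"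

definition rayleigh_det ::
    "(real \<Rightarrow> real) \<Rightarrow> (real \<Rightarrow> real) \<Rightarrow> complex \<Rightarrow> (real \<Rightarrow> complex^2) \<Rightarrow> (real \<Rightarrow> complex^2) \<Rightarrow> complex" where
  "rayleigh_det lam mu \<xi> psiPm psiSm =
     a_hat lam mu \<xi> psiPm * b_hat lam mu \<xi> psiSm - a_hat lam mu \<xi> psiSm * b_hat lam mu \<xi> psiPm"

text \<open>\<open>G Z Z'\<close> is the Green's function on the half line. The equation with right-hand side
  \<open>\<delta>(Z - Z') I\<close> is expressed by its classical form: the homogeneous equation off \<open>Z = Z'\<close>,
  continuity across \<open>Z'\<close>, and a jump of \<open>P \<partial>G/\<partial>Z\<close> by the identity matrix at \<open>Z'\<close>. Only
  negative arguments matter.\<close>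

definition greens_function ::
    "real \<Rightarrow> (real \<Rightarrow> real) \<Rightarrow> (real \<Rightarrow> real) \<Rightarrow> complex \<Rightarrow> (real \<Rightarrow> real \<Rightarrow> complex^2^2) \<Rightarrow> bool" where
  "greens_function \<omega> lam mu \<xi> G \<longleftrightarrow>
     (\<forall>Z'<0.
        (\<forall>j. rayleigh_solution \<omega> lam mu \<xi> ({..<0} - {Z'}) (\<lambda>Z. column j (G Z Z'))) \<and>
        isCont (\<lambda>Z. G Z Z') Z' \<and>
        (\<exists>Tl Tr.
           ((\<lambda>Z. P_mat lam mu Z ** ddz (\<lambda>z. G z Z') Z) \<longlongrightarrow> Tl) (at_left Z') \<and>
           ((\<lambda>Z. P_mat lam mu Z ** ddz (\<lambda>z. G z Z') Z) \<longlongrightarrow> Tr) (at_right Z') \<and>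
           Tr - Tl = mat 1) \<and>
        (\<forall>j. traction_free lam mu \<xi> (\<lambda>Z. column j (G Z Z'))) \<and>
        ((\<lambda>Z. G Z Z') \<longlongrightarrow> 0) at_bot)"

text \<open>The matrix \<open>x y\<^sup>T\<close>.\<close>

definition outer_prod :: "complex^2 \<Rightarrow> complex^2 \<Rightarrow> complex^2^2" where
  "outer_prod x y = (\<chi> i j. x $ i * y $ j)"

definition cscale :: "complex \<Rightarrow> complex^2^2 \<Rightarrow> complex^2^2" where
  "cscale c A = (\<chi> i j. c * A $ i $ j)"

end

theory Submission
  imports Defs
begin

text \<open>With the traction \<open>\<tau> = P \<psi>' - \<xi> N\<^sup>T \<psi>\<close> the Rayleigh equation becomes a linear first-order
  system for \<open>(\<psi>, \<tau>)\<close> whose symplectic form, the Wronskian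
  \<open>\<psi> \<cdot> \<upsilon> - \<phi> \<cdot> \<tau>\<close>, is constant along pairs of solutions. It vanishes on pairs
  of traction-free solutions and on \<open>\<psi>\<^sub>P\<^sup>-, \<psi>\<^sub>S\<^sup>-\<close>, while the pairings
  \<open>\<psi>\<^sub>P\<^sup>-, g\<^sub>P\<^sup>+\<close> and \<open>\<psi>\<^sub>S\<^sup>-, g\<^sub>S\<^sup>+\<close> equal \<open>2 \<i> \<omega>\<^sup>2 q\<close>; so the four solutions form a
  symplectic basis up to scaling. Expanding \<open>(0, e\<^sub>j)\<close> in this basis gives both
  the continuity and the jump of the kernel. Conversely, a column of any Green's function has zero
  Wronskian with \<open>g\<^sub>P\<^sup>+, g\<^sub>S\<^sup>+\<close> to the right of the source by the boundary condition, and with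
  \<open>\<psi>\<^sub>P\<^sup>-, \<psi>\<^sub>S\<^sup>-\<close> to the left of it by decay; the jump condition fixes the remaining coefficients.\<close>

section \<open>Componentwise calculus and endpoint limits of linear systems\<close>

lemma has_vector_derivative_vec_iff:
  fixes f :: "real \<Rightarrow> 'a::real_normed_vector^'n"
  shows "(f has_vector_derivative f') (at x within S) \<longleftrightarrow>
    (\<forall>i. ((\<lambda>x. f x $ i) has_vector_derivative f' $ i) (at x within S))"
proof
  assume "(f has_vector_derivative f') (at x within S)"
  then show "\<forall>i. ((\<lambda>x. f x $ i) has_vector_derivative f' $ i) (at x within S)"
    by (auto intro: bounded_linear.has_vector_derivative[OF bounded_linear_vec_nth])
next
  assume "\<forall>i. ((\<lambda>x. f x $ i) has_vector_derivative f' $ i) (at x within S)"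
  then show "(f has_vector_derivative f') (at x within S)"
    unfolding has_vector_derivative_def has_derivative_def
    by (auto intro!: vec_tendstoI bounded_linear_scaleR_left)
qed

lemma vec2_eq_iff: "(x :: 'a^2) = y \<longleftrightarrow> x $ 1 = y $ 1 \<and> x $ 2 = y $ 2"
  by (simp add: vec_eq_iff forall_2)

lemma tendsto_vec2_iff:
  fixes f :: "'b \<Rightarrow> 'a::topological_space^2"
  shows "(f \<longlongrightarrow> l) F \<longleftrightarrow> ((\<lambda>x. f x $ 1) \<longlongrightarrow> l $ 1) F \<and> ((\<lambda>x. f x $ 2) \<longlongrightarrow> l $ 2) F"
proof (intro iffI conjI tendsto_vec_nth)
  assume "((\<lambda>x. f x $ 1) \<longlongrightarrow> l $ 1) F \<and> ((\<lambda>x. f x $ 2) \<longlongrightarrow> l $ 2) F"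
  then have "\<forall>i. ((\<lambda>x. f x $ i) \<longlongrightarrow> l $ i) F"
    by (simp add: forall_2)
  then show "(f \<longlongrightarrow> l) F"
    by (auto intro: vec_tendstoI)
qed

lemma has_vector_derivative_vec2_iff:
  fixes f :: "real \<Rightarrow> 'a::real_normed_vector^2"
  shows "(f has_vector_derivative f') (at x within S) \<longleftrightarrow>
    ((\<lambda>x. f x $ 1) has_vector_derivative f' $ 1) (at x within S) \<and>
    ((\<lambda>x. f x $ 2) has_vector_derivative f' $ 2) (at x within S)"
  by (simp add: has_vector_derivative_vec_iff forall_2)

lemma bounded_linear_smult: "bounded_linear (\<lambda>x :: complex^'n. c *s x)"
proof -
  have "linear (\<lambda>x :: complex^'n. c *s x)"
    by (rule linearI) (simp_all add: vec_eq_iff algebra_simps)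
  then show ?thesis
    by (simp add: linear_conv_bounded_linear)
qed

lemmas has_vector_derivative_smult =
  bounded_linear.has_vector_derivative[OF bounded_linear_smult]

lemma tendsto_smult: "(\<phi> \<longlongrightarrow> l) F \<Longrightarrow> ((\<lambda>Z. c *s \<phi> Z) \<longlongrightarrow> c *s (l :: complex^'n)) F"
  by (rule bounded_linear.tendsto[OF bounded_linear_smult])

lemma eventually_left_right:
  fixes Z' :: real
  assumes "Z' < 0"
  shows "eventually (\<lambda>Z. Z < Z') (at_left Z')" "eventually (\<lambda>Z. Z' < Z \<and> Z < 0) (at_right Z')"
  using assms by (auto simp: eventually_at_left_field eventually_at_right_field intro: exI[of _ "Z' - 1"] exI[of _ 0])

text \<open>Gronwall's inequality bounds \<open>y\<close>, hence \<open>y'\<close>, so \<open>y\<close> is Lipschitz near \<open>b\<close>.\<close>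

lemma linear_growth_ode_has_limit:
  fixes y :: "real \<Rightarrow> 'a::euclidean_space"
  assumes "a < b"
    and der: "\<And>t. a < t \<Longrightarrow> t < b \<Longrightarrow> (y has_vector_derivative y' t) (at t)"
    and bnd: "\<And>t. a < t \<Longrightarrow> t < b \<Longrightarrow> norm (y' t) \<le> K * norm (y t)"
  shows "\<exists>l. (y \<longlongrightarrow> l) (at_left b)"
proof -
  define c where "c = (a + b) / 2"
  have c: "a < c" "c < b" using \<open>a < b\<close> by (auto simp: c_def)
  \<comment> \<open>No sign of \<open>K\<close> is assumed; \<open>max K 0\<close> keeps the bound
    and makes the Gronwall factor nondecreasing in \<open>t\<close>.\<close>
  define L where "L = max K 0"
  have bndL: "norm (y' t) \<le> L * norm (y t)" if "a < t" "t < b" for t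
    using bnd[OF that] mult_right_mono[of K L "norm (y t)"] by (simp add: L_def)
  have "L \<ge> 0" by (simp add: L_def)
  \<comment> \<open>Integrating factor: the squared norm is differentiable even where
    \<open>y\<close> vanishes and grows at relative rate at most \<open>2 * L\<close>, so
    \<open>n\<close> does not increase to the right of \<open>c\<close>.\<close>
  define n where "n t = (y t \<bullet> y t) * exp (- 2 * L * (t - c))" for t
  have n_der: "(n has_real_derivative (2 * (y t \<bullet> y' t) - 2 * L * (y t \<bullet> y t)) * exp (- 2 * L * (t - c))) (at t)"
    if "a < t" "t < b" for t
  proof -
    have "((\<lambda>t. y t \<bullet> y t) has_vector_derivative (y t \<bullet> y' t + y' t \<bullet> y t)) (at t)"
      by (rule bounded_bilinear.has_vector_derivative[OF bounded_bilinear_inner der[OF that] der[OF that]])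
    then have "((\<lambda>t. y t \<bullet> y t) has_real_derivative 2 * (y t \<bullet> y' t)) (at t)"
      by (simp add: has_real_derivative_iff_has_vector_derivative inner_commute)
    then show ?thesis
      unfolding n_def by (auto intro!: derivative_eq_intros simp: algebra_simps)
  qed
  have n_le: "n t \<le> n c" if "c \<le> t" "t < b" for t
  proof (rule DERIV_nonpos_imp_nonincreasing[OF that(1)])
    fix s assume s: "c \<le> s" "s \<le> t"
    then have s': "a < s" "s < b" using c that by auto
    have "y s \<bullet> y' s \<le> norm (y s) * norm (y' s)" by (rule norm_cauchy_schwarz)
    also have "\<dots> \<le> norm (y s) * (L * norm (y s))"
      by (intro mult_left_mono bndL s') simp
    finally have "2 * (y s \<bullet> y' s) - 2 * L * (y s \<bullet> y s) \<le> 0"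
      by (simp add: power2_norm_eq_inner[symmetric] power2_eq_square mult.left_commute)
    then show "\<exists>d. (n has_real_derivative d) (at s) \<and> d \<le> 0"
      using n_der[OF s'] by (meson exp_ge_zero mult_nonpos_nonneg)
  qed
  define B where "B = norm (y c) * exp (L * (b - c))"
  have y_le: "norm (y t) \<le> B" if "c < t" "t < b" for t
  proof -
    have "norm (y t)^2 = n t * exp (2 * L * (t - c))"
      by (simp add: n_def power2_norm_eq_inner mult_exp_exp)
    also have "\<dots> \<le> n c * exp (2 * L * (t - c))"
      using n_le[of t] that by simp
    also have "\<dots> = (norm (y c))^2 * exp (2 * L * (t - c))"
      by (simp add: n_def power2_norm_eq_inner)
    also have "\<dots> \<le> (norm (y c))^2 * exp (2 * L * (b - c))"
      using that \<open>L \<ge> 0\<close> by (intro mult_left_mono) (auto intro: mult_left_mono)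
    also have "\<dots> = B\<^sup>2"
      by (simp add: B_def power_mult_distrib power2_eq_square mult_exp_exp)
    finally show ?thesis
      by (rule power2_le_imp_le) (simp add: B_def)
  qed
  have lip: "norm (y s - y t) \<le> (L * B) * norm (s - t)" if "s \<in> {c<..<b}" "t \<in> {c<..<b}" for s t
  proof (rule differentiable_bound[OF _ _ _ that(1,2)])
    show "convex {c<..<b}" by simp
    fix x assume x: "x \<in> {c<..<b}"
    show "(y has_derivative (\<lambda>h. h *\<^sub>R y' x)) (at x within {c<..<b})"
      using der[of x] x c has_derivative_at_withinI unfolding has_vector_derivative_def by force
    have "norm (y' x) \<le> L * B"
      using bndL[of x] y_le[of x] x c \<open>L \<ge> 0\<close>
      by (smt (verit) greaterThanLessThan_iff mult_left_mono)
    then show "onorm (\<lambda>h. h *\<^sub>R y' x) \<le> L * B"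
      by (intro onorm_le) (simp add: mult.commute mult_left_mono)
  qed
  have "L * B \<ge> 0" using \<open>L \<ge> 0\<close> by (simp add: B_def)
  then have "(L * B)-lipschitz_on {c<..<b} y"
    using lip by (intro lipschitz_onI) (auto simp: dist_norm)
  \<comment> \<open>A uniformly continuous map into a complete space extends to the closure, which
    supplies the limit at \<open>b\<close>.\<close>
  then have "uniformly_continuous_on {c<..<b} y"
    by (rule lipschitz_on_uniformly_continuous)
  moreover have "b \<in> closure {c<..<b}" using c by simp
  ultimately obtain l where "(y \<longlongrightarrow> l) (at b within {c<..<b})"
    by (rule uniformly_continuous_on_extension_at_closure)
  moreover have "at b within {c<..<b} = at_left b"
    using c by (intro at_within_nhd[of b "{c<..}"]) auto
  ultimately show ?thesis by auto
qed

section \<open>Symplectic linear algebra on position-traction pairs\<close>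

definition wronskian :: "complex^2 \<Rightarrow> complex^2 \<Rightarrow> complex^2 \<Rightarrow> complex^2 \<Rightarrow> complex" where
  "wronskian x t y u = x $ 1 * u $ 1 + x $ 2 * u $ 2 - y $ 1 * t $ 1 - y $ 2 * t $ 2"

text \<open>No complex conjugation enters the form: it is bilinear, so scalars come out of either
  pair unchanged.\<close>

lemma wronskian_simps:
  "wronskian x t (y + y') (u + u') = wronskian x t y u + wronskian x t y' u'"
  "wronskian x t (c *s y) (c *s u) = c * wronskian x t y u"
  "wronskian (c *s x) (c *s t) y u = c * wronskian x t y u"
  "wronskian x t x t = 0"
  by (simp_all add: wronskian_def algebra_simps)

lemma wronskian_anticommute: "wronskian x t y u = - wronskian y u x t"
  by (simp add: wronskian_def)

text \<open>The pair (0, e_j) is the jump of the state caused by a unit point force in direction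
  \<open>j\<close>. Pairing with it evaluates a solution at the source, which is how source values
  become coefficients of the kernel.\<close>

lemma wronskian_axis: "wronskian x t 0 (axis j 1) = x $ j"
  using exhaust_2[of j] by (auto simp: wronskian_def axis_def)

lemma tendsto_wronskian:
  assumes "(x \<longlongrightarrow> x') F" "(t \<longlongrightarrow> t') F" "(y \<longlongrightarrow> y') F" "(u \<longlongrightarrow> u') F"
  shows "((\<lambda>Z. wronskian (x Z) (t Z) (y Z) (u Z)) \<longlongrightarrow> wronskian x' t' y' u') F"
  unfolding wronskian_def by (intro tendsto_intros assms)

lemma vector_4:
  "(vector [a,b,c,d] :: 'a::zero^4) $ 1 = a" "(vector [a,b,c,d] :: 'a^4) $ 2 = b"
  "(vector [a,b,c,d] :: 'a^4) $ 3 = c" "(vector [a,b,c,d] :: 'a^4) $ 4 = d"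
  unfolding vector_def by simp_all

text \<open>The six relations say that the matrix of normalised pairings is a left inverse of the
  matrix with columns \<open>g, p, h, s\<close>. Both are square, so it is also a right inverse, and
  that identity is the expansion; linear independence comes for free.\<close>

lemma symplectic_basis_expansion:
  fixes p s g h x tp ts tg th t :: "complex^2"
  assumes ps: "wronskian p tp s ts = 0" and gh: "wronskian g tg h th = 0"
    and ph: "wronskian p tp h th = 0" and sg: "wronskian s ts g tg = 0"
    and pg: "wronskian p tp g tg = a" and sh: "wronskian s ts h th = b"
    and nz: "a \<noteq> 0" "b \<noteq> 0"
  shows "x = (wronskian p tp x t / a) *s g - (wronskian g tg x t / a) *s p
           + (wronskian s ts x t / b) *s h - (wronskian h th x t / b) *s s"
    and "t = (wronskian p tp x t / a) *s tg - (wronskian g tg x t / a) *s tp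
           + (wronskian s ts x t / b) *s th - (wronskian h th x t / b) *s ts"
proof -
  \<comment> \<open>\<open>row y u c\<close> represents the functional \<open>wronskian y u\<close>
    divided by \<open>c\<close>, acting on pairs stored as \<open>col\<close>.\<close>
  define row :: "complex^2 \<Rightarrow> complex^2 \<Rightarrow> complex \<Rightarrow> complex^4"
    where "row y u c = vector [- u$1 / c, - u$2 / c, y$1 / c, y$2 / c]" for y u c
  define col :: "complex^2 \<Rightarrow> complex^2 \<Rightarrow> complex^4"
    where "col y u = vector [y$1, y$2, u$1, u$2]" for y u
  \<comment> \<open>Rows dual to the columns of \<open>C\<close>. By antisymmetry \<open>g\<close>
    with \<open>p\<close> and \<open>h\<close> with \<open>s\<close> pair to \<open>- a\<close> and
    \<open>- b\<close>, hence the negated divisors.\<close>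
  define A where "A = (vector [row p tp a, row g tg (- a), row s ts b, row h th (- b)] :: complex^4^4)"
  define C where "C = (vector [col g tg, col p tp, col h th, col s ts] :: complex^4^4)"
  have row_col: "(\<Sum>k\<in>UNIV. row y u c $ k * col z v $ k) = wronskian y u z v / c" for y u c z v
    by (simp add: row_def col_def vector_4 sum_4 wronskian_def add_divide_distrib diff_divide_distrib mult.commute)
  note anti = wronskian_anticommute
  have "A ** transpose C = mat 1"
    using assms anti[of g tg p tp] anti[of h th s ts] anti[of s ts p tp] anti[of h th g tg]
      anti[of h th p tp] anti[of g tg s ts]
    by (simp add: vec_eq_iff forall_4 matrix_matrix_mult_def transpose_def mat_def A_def C_def
        vector_4 row_col wronskian_simps(4))
  then have "transpose C ** A = mat 1"
    using matrix_left_right_inverse by blast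
  then have "transpose C *v (A *v col x t) = col x t"
    by (simp add: matrix_vector_mul_assoc)
  moreover have "A *v col x t = vector [wronskian p tp x t / a, - (wronskian g tg x t / a),
      wronskian s ts x t / b, - (wronskian h th x t / b)]"
    by (simp add: vec_eq_iff forall_4 matrix_vector_mult_def A_def vector_4 row_col)
  ultimately have "transpose C *v vector [wronskian p tp x t / a, - (wronskian g tg x t / a),
      wronskian s ts x t / b, - (wronskian h th x t / b)] = col x t"
    by simp
  note * = this[unfolded vec_eq_iff forall_4 matrix_vector_mult_def transpose_def C_def col_def,
      simplified vector_4 sum_4 vec_lambda_beta]
  show "x = (wronskian p tp x t / a) *s g - (wronskian g tg x t / a) *s p
           + (wronskian s ts x t / b) *s h - (wronskian h th x t / b) *s s"
    and "t = (wronskian p tp x t / a) *s tg - (wronskian g tg x t / a) *s tp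
           + (wronskian s ts x t / b) *s th - (wronskian h th x t / b) *s ts"
    using * by (simp_all add: vec2_eq_iff mult.commute)
qed

subsection \<open>The first-order system\<close>

text \<open>As a simp rule it turns \<open>transpose A *v x\<close> into \<open>x v* A\<close>,
  which would hide the left-hand side of the last rule in
  \<open>coefficient_matrix_mult\<close>.\<close>

declare transpose_matrix_vector [simp del]

lemma coefficient_matrix_mult:
  "P_mat lam mu Z *v x = vector [of_real (mu Z) * x $ 1, of_real (lam Z + 2 * mu Z) * x $ 2]"
  "M_mat lam mu Z *v x = vector [of_real (lam Z + 2 * mu Z) * x $ 1, of_real (mu Z) * x $ 2]"
  "N_mat lam mu Z *v x = vector [- of_real (lam Z) * x $ 2, of_real (mu Z) * x $ 1]"
  "transpose (N_mat lam mu Z) *v x = vector [of_real (mu Z) * x $ 2, - of_real (lam Z) * x $ 1]"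
  by (simp_all add: P_mat_def M_mat_def N_mat_def matrix_vector_mult_def transpose_def vec2_eq_iff sum_2)

text \<open>With this \<tau> the Rayleigh operator is \<open>\<tau>' + \<xi> N \<psi>' +
  (\<omega>\<^sup>2 - \<xi>\<^sup>2 M) \<psi>\<close>. At the surface its components are
  \<open>b_hat\<close> and \<open>- \<i> * a_hat\<close>, so one vector carries both the equation
  and the boundary condition.\<close>

definition traction :: "(real \<Rightarrow> real) \<Rightarrow> (real \<Rightarrow> real) \<Rightarrow> complex \<Rightarrow> (real \<Rightarrow> complex^2) \<Rightarrow> real \<Rightarrow> complex^2" where
  "traction lam mu \<xi> \<phi> Z = P_mat lam mu Z *v ddz \<phi> Z - \<xi> *s (transpose (N_mat lam mu Z) *v \<phi> Z)"

text \<open>Continuity and positivity reach up to 0, because the first-order system is used up to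
  the surface; differentiability inside is what allows \<open>transpose N *v \<phi>\<close> to be
  differentiated.\<close>

locale elastic_half_line =
  fixes \<omega> :: real and lam mu :: "real \<Rightarrow> real" and \<xi> :: complex
  assumes lam_cont: "continuous_on {..0} lam" and mu_cont: "continuous_on {..0} mu"
    and lam_diff: "\<And>Z. Z < 0 \<Longrightarrow> lam differentiable (at Z)"
    and mu_diff: "\<And>Z. Z < 0 \<Longrightarrow> mu differentiable (at Z)"
    and mu_pos: "\<And>Z. Z \<le> 0 \<Longrightarrow> mu Z > 0"
    and sigma_pos: "\<And>Z. Z \<le> 0 \<Longrightarrow> lam Z + 2 * mu Z > 0"
begin

text \<open>\<open>slope\<close> and \<open>force\<close> are the values of \<open>\<psi>'\<close> and \<open>\<tau>'\<close> in terms of \<open>\<psi>\<close> and \<open>\<tau>\<close>.\<close>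

definition slope :: "real \<Rightarrow> complex^2 \<Rightarrow> complex^2 \<Rightarrow> complex^2" where
  "slope Z x t = vector [t $ 1 / of_real (mu Z) + \<xi> * x $ 2,
                         (t $ 2 - \<xi> * of_real (lam Z) * x $ 1) / of_real (lam Z + 2 * mu Z)]"

definition force :: "real \<Rightarrow> complex^2 \<Rightarrow> complex^2 \<Rightarrow> complex^2" where
  "force Z x t =
     vector [\<xi> * of_real (lam Z) * slope Z x t $ 2 - (of_real (\<omega>\<^sup>2) - \<xi>\<^sup>2 * of_real (lam Z + 2 * mu Z)) * x $ 1,
             - \<xi> * of_real (mu Z) * slope Z x t $ 1 - (of_real (\<omega>\<^sup>2) - \<xi>\<^sup>2 * of_real (mu Z)) * x $ 2]"

text \<open>\<tau> is a separate argument instead of \<open>trac \<phi>\<close>, so that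
  superposition acts on explicit pairs; \<open>state_traction\<close> shows that it is nevertheless
  determined by \<phi>.\<close>

definition state :: "real set \<Rightarrow> (real \<Rightarrow> complex^2) \<Rightarrow> (real \<Rightarrow> complex^2) \<Rightarrow> bool" where
  "state S \<phi> \<tau> \<longleftrightarrow> (\<forall>Z\<in>S. (\<phi> has_vector_derivative slope Z (\<phi> Z) (\<tau> Z)) (at Z) \<and>
                         (\<tau> has_vector_derivative force Z (\<phi> Z) (\<tau> Z)) (at Z))"

abbreviation "trac \<equiv> traction lam mu \<xi>"

lemma coefficients_nonzero:
  assumes "Z \<le> 0"
  shows "complex_of_real (mu Z) \<noteq> 0" "complex_of_real (lam Z + 2 * mu Z) \<noteq> 0"
    "complex_of_real (lam Z) + 2 * complex_of_real (mu Z) \<noteq> 0"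
proof -
  show "complex_of_real (mu Z) \<noteq> 0" and *: "complex_of_real (lam Z + 2 * mu Z) \<noteq> 0"
    using mu_pos[OF assms] sigma_pos[OF assms] by (simp_all only: of_real_eq_0_iff)
  from * show "complex_of_real (lam Z) + 2 * complex_of_real (mu Z) \<noteq> 0" by simp
qed

lemma slope_traction:
  assumes "Z \<le> 0"
  shows "slope Z (\<phi> Z) (trac \<phi> Z) = ddz \<phi> Z"
  using coefficients_nonzero[OF assms]
  by (simp add: slope_def traction_def coefficient_matrix_mult vec2_eq_iff field_simps)

lemma P_slope:
  assumes "Z \<le> 0"
  shows "P_mat lam mu Z *v slope Z x t = t + \<xi> *s (transpose (N_mat lam mu Z) *v x)"
  using coefficients_nonzero[OF assms]
  by (simp add: slope_def coefficient_matrix_mult vec2_eq_iff field_simps)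

lemma force_eq:
  "force Z x t = - (\<xi> *s (N_mat lam mu Z *v slope Z x t))
     - (of_real (\<omega>\<^sup>2) *s x - \<xi>\<^sup>2 *s (M_mat lam mu Z *v x))"
  by (simp add: force_def coefficient_matrix_mult vec2_eq_iff algebra_simps)

lemma state_subset: "state S \<phi> \<tau> \<Longrightarrow> T \<subseteq> S \<Longrightarrow> state T \<phi> \<tau>"
  by (auto simp: state_def)

lemma state_ddz: "state S \<phi> \<tau> \<Longrightarrow> Z \<in> S \<Longrightarrow> ddz \<phi> Z = slope Z (\<phi> Z) (\<tau> Z)"
  by (auto simp: state_def intro: vector_derivative_at)

lemma state_traction:
  assumes "state S \<phi> \<tau>" "Z \<in> S" "Z \<le> 0"
  shows "trac \<phi> Z = \<tau> Z"
  using P_slope[OF \<open>Z \<le> 0\<close>] state_ddz[OF assms(1,2)] by (simp add: traction_def)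

lemma state_cong:
  assumes "state S \<phi> \<tau>" "open S" "\<And>Z. Z \<in> S \<Longrightarrow> \<phi> Z = \<phi>' Z" "\<And>Z. Z \<in> S \<Longrightarrow> \<tau> Z = \<tau>' Z"
  shows "state S \<phi>' \<tau>'"
  unfolding state_def
proof
  fix Z assume Z: "Z \<in> S"
  note t = has_vector_derivative_transform_within_open[OF _ \<open>open S\<close> Z]
  have "(\<phi> has_vector_derivative slope Z (\<phi>' Z) (\<tau>' Z)) (at Z)"
    "(\<tau> has_vector_derivative force Z (\<phi>' Z) (\<tau>' Z)) (at Z)"
    using assms Z by (auto simp: state_def)
  then show "(\<phi>' has_vector_derivative slope Z (\<phi>' Z) (\<tau>' Z)) (at Z) \<and>
      (\<tau>' has_vector_derivative force Z (\<phi>' Z) (\<tau>' Z)) (at Z)"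
    using assms(3,4) by (auto intro: t)
qed

text \<open>A classical solution has \<open>P \<phi>'\<close> differentiable; this supplies the
  other summand of the traction, so the two can be differentiated separately.\<close>

lemma transpose_N_differentiable:
  assumes "Z < 0" "\<phi> differentiable (at Z)"
  shows "(\<lambda>z. transpose (N_mat lam mu z) *v \<phi> z) differentiable (at Z)"
proof -
  obtain dl dm where d: "(lam has_real_derivative dl) (at Z)" "(mu has_real_derivative dm) (at Z)"
    using lam_diff[OF assms(1)] mu_diff[OF assms(1)] by (meson real_differentiable_def)
  obtain d\<phi> where "(\<phi> has_vector_derivative d\<phi>) (at Z)"
    using assms(2) by (meson vector_derivative_works)
  then have p: "((\<lambda>z. \<phi> z $ 1) has_vector_derivative d\<phi> $ 1) (at Z)"
      "((\<lambda>z. \<phi> z $ 2) has_vector_derivative d\<phi> $ 2) (at Z)"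
    by (simp_all add: has_vector_derivative_vec2_iff)
  note c = d[THEN has_vector_derivative_of_real, where 'a = complex]
  have "((\<lambda>z. transpose (N_mat lam mu z) *v \<phi> z) has_vector_derivative
      vector [of_real (mu Z) * d\<phi> $ 2 + of_real dm * \<phi> Z $ 2,
              - (of_real (lam Z) * d\<phi> $ 1 + of_real dl * \<phi> Z $ 1)]) (at Z)"
    using has_vector_derivative_mult[OF c(2) p(2)]
      has_vector_derivative_minus[OF has_vector_derivative_mult[OF c(1) p(1)]]
    by (simp add: coefficient_matrix_mult has_vector_derivative_vec2_iff)
  then show ?thesis
    by (rule differentiableI_vector)
qed

text \<open>Since P is invertible, the definition of the traction can be solved for
  \<open>\<phi>'\<close>; the Rayleigh equation, solved for the derivative of the traction, is then
  the second half of the system.\<close>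

lemma rayleigh_solution_iff_state:
  assumes "open S" "S \<subseteq> {..<0}"
  shows "rayleigh_solution \<omega> lam mu \<xi> S \<phi> \<longleftrightarrow> state S \<phi> (trac \<phi>)"
proof
  assume sol: "rayleigh_solution \<omega> lam mu \<xi> S \<phi>"
  show "state S \<phi> (trac \<phi>)"
    unfolding state_def
  proof (intro ballI conjI)
    fix Z assume "Z \<in> S"
    then have Z: "Z < 0" and d: "\<phi> differentiable (at Z)"
      "(\<lambda>z. P_mat lam mu z *v ddz \<phi> z) differentiable (at Z)"
      and op: "rayleigh_op \<omega> lam mu \<xi> \<phi> Z = 0"
      using sol assms by (auto simp: rayleigh_solution_def)
    show "(\<phi> has_vector_derivative slope Z (\<phi> Z) (trac \<phi> Z)) (at Z)"
      using d(1) Z slope_traction[of Z \<phi>] by (simp add: vector_derivative_works[symmetric])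
    have "(trac \<phi> has_vector_derivative ddz (\<lambda>z. P_mat lam mu z *v ddz \<phi> z) Z
        - \<xi> *s ddz (\<lambda>z. transpose (N_mat lam mu z) *v \<phi> z) Z) (at Z)"
      unfolding traction_def
      by (intro has_vector_derivative_diff has_vector_derivative_smult)
         (use d transpose_N_differentiable[OF Z d(1)] in \<open>simp_all add: vector_derivative_works\<close>)
    also have "ddz (\<lambda>z. P_mat lam mu z *v ddz \<phi> z) Z
        - \<xi> *s ddz (\<lambda>z. transpose (N_mat lam mu z) *v \<phi> z) Z = force Z (\<phi> Z) (trac \<phi> Z)"
      using op
      by (simp add: slope_traction[OF less_imp_le[OF Z]] rayleigh_op_def force_eq vec2_eq_iff algebra_simps eq_neg_iff_add_eq_0)
    finally show "(trac \<phi> has_vector_derivative force Z (\<phi> Z) (trac \<phi> Z)) (at Z)" .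
  qed
next
  assume st: "state S \<phi> (trac \<phi>)"
  show "rayleigh_solution \<omega> lam mu \<xi> S \<phi>"
    unfolding rayleigh_solution_def
  proof (intro ballI conjI)
    fix Z assume "Z \<in> S"
    then have Z: "Z < 0" and d: "(\<phi> has_vector_derivative slope Z (\<phi> Z) (trac \<phi> Z)) (at Z)"
      "(trac \<phi> has_vector_derivative force Z (\<phi> Z) (trac \<phi> Z)) (at Z)"
      using st assms by (auto simp: state_def)
    show diff: "\<phi> differentiable (at Z)"
      using d(1) by (rule differentiableI_vector)
    have eq: "P_mat lam mu z *v ddz \<phi> z = trac \<phi> z + \<xi> *s (transpose (N_mat lam mu z) *v \<phi> z)" for z
      by (simp add: traction_def)
    \<comment> \<open>The derivative of \<open>transpose N *v \<phi>\<close> is left unevaluated,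
      since it cancels against the same term in \<open>rayleigh_op\<close>.\<close>
    have D: "((\<lambda>z. P_mat lam mu z *v ddz \<phi> z) has_vector_derivative
        force Z (\<phi> Z) (trac \<phi> Z) + \<xi> *s ddz (\<lambda>z. transpose (N_mat lam mu z) *v \<phi> z) Z) (at Z)"
      unfolding eq
      by (intro has_vector_derivative_add has_vector_derivative_smult d)
         (use transpose_N_differentiable[OF Z diff] in \<open>simp add: vector_derivative_works\<close>)
    then show "(\<lambda>z. P_mat lam mu z *v ddz \<phi> z) differentiable (at Z)"
      by (rule differentiableI_vector)
    show "rayleigh_op \<omega> lam mu \<xi> \<phi> Z = 0"
      by (simp add: slope_traction[OF less_imp_le[OF Z]] rayleigh_op_def vector_derivative_at[OF D] force_eq vec2_eq_iff algebra_simps)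
  qed
qed

lemma state_imp_rayleigh_solution:
  assumes "state S \<phi> \<tau>" "open S" "S \<subseteq> {..<0}"
  shows "rayleigh_solution \<omega> lam mu \<xi> S \<phi>"
  unfolding rayleigh_solution_iff_state[OF assms(2,3)]
  by (rule state_cong[OF assms(1,2)]) (use state_traction[OF assms(1)] assms(3) in auto)

lemma slope_linear:
  "slope Z (x + y) (t + u) = slope Z x t + slope Z y u"
  "slope Z (c *s x) (c *s t) = c *s slope Z x t"
  by (simp_all add: slope_def vec2_eq_iff algebra_simps add_divide_distrib diff_divide_distrib)

lemma force_linear:
  "force Z (x + y) (t + u) = force Z x t + force Z y u"
  "force Z (c *s x) (c *s t) = c *s force Z x t"
  by (simp_all add: force_def slope_linear vec2_eq_iff algebra_simps)

lemma state_add: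
  assumes "state S \<phi> \<tau>" "state S \<psi> \<upsilon>"
  shows "state S (\<lambda>Z. \<phi> Z + \<psi> Z) (\<lambda>Z. \<tau> Z + \<upsilon> Z)"
  using assms unfolding state_def slope_linear force_linear
  by (auto intro: has_vector_derivative_add)

lemma state_smult:
  assumes "state S \<phi> \<tau>"
  shows "state S (\<lambda>Z. c *s \<phi> Z) (\<lambda>Z. c *s \<tau> Z)"
  using assms unfolding state_def slope_linear force_linear
  by (auto intro: has_vector_derivative_smult)

lemma state_continuous:
  assumes "state S \<phi> \<tau>" "Z \<in> S"
  shows "isCont \<phi> Z" "isCont \<tau> Z"
  using assms unfolding state_def by (auto intro: has_vector_derivative_continuous)

text \<open>The system is Hamiltonian: its coefficient matrix is infinitesimally symplectic, so the
  form of two solutions has derivative zero.\<close>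

lemma wronskian_constant:
  assumes "state S \<phi> \<tau>" "state S \<psi> \<upsilon>" "convex S" "S \<subseteq> {..<0}" "Z \<in> S" "Z' \<in> S"
  shows "wronskian (\<phi> Z) (\<tau> Z) (\<psi> Z) (\<upsilon> Z) = wronskian (\<phi> Z') (\<tau> Z') (\<psi> Z') (\<upsilon> Z')"
proof -
  have "((\<lambda>Z. wronskian (\<phi> Z) (\<tau> Z) (\<psi> Z) (\<upsilon> Z)) has_vector_derivative 0) (at Y within S)"
    if "Y \<in> S" for Y
  proof -
    \<comment> \<open>Expressing the tractions through the slopes turns the derivative into terms
      symmetric in the two solutions, which cancel without any division.\<close>
    have tr: "t $ 1 = of_real (mu Y) * (slope Y x t $ 1 - \<xi> * x $ 2)"
        "t $ 2 = of_real (lam Y + 2 * mu Y) * slope Y x t $ 2 + \<xi> * of_real (lam Y) * x $ 1" for x t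
      using P_slope[of Y x t] that assms(4) by (auto simp: coefficient_matrix_mult vec2_eq_iff algebra_simps)
    from assms(1,2) that
    have d: "(\<phi> has_vector_derivative slope Y (\<phi> Y) (\<tau> Y)) (at Y within S)"
      "(\<tau> has_vector_derivative force Y (\<phi> Y) (\<tau> Y)) (at Y within S)"
      "(\<psi> has_vector_derivative slope Y (\<psi> Y) (\<upsilon> Y)) (at Y within S)"
      "(\<upsilon> has_vector_derivative force Y (\<psi> Y) (\<upsilon> Y)) (at Y within S)"
      by (auto simp: state_def intro: has_vector_derivative_at_within)
    note c = d[unfolded has_vector_derivative_vec2_iff]
    note m = has_vector_derivative_mult
    have "((\<lambda>Z. wronskian (\<phi> Z) (\<tau> Z) (\<psi> Z) (\<upsilon> Z)) has_vector_derivative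
       ((\<phi> Y $ 1 * force Y (\<psi> Y) (\<upsilon> Y) $ 1 + slope Y (\<phi> Y) (\<tau> Y) $ 1 * \<upsilon> Y $ 1)
       + (\<phi> Y $ 2 * force Y (\<psi> Y) (\<upsilon> Y) $ 2 + slope Y (\<phi> Y) (\<tau> Y) $ 2 * \<upsilon> Y $ 2)
       - (\<psi> Y $ 1 * force Y (\<phi> Y) (\<tau> Y) $ 1 + slope Y (\<psi> Y) (\<upsilon> Y) $ 1 * \<tau> Y $ 1)
       - (\<psi> Y $ 2 * force Y (\<phi> Y) (\<tau> Y) $ 2 + slope Y (\<psi> Y) (\<upsilon> Y) $ 2 * \<tau> Y $ 2))) (at Y within S)"
      unfolding wronskian_def
      by (intro has_vector_derivative_add has_vector_derivative_diff m) (use c in auto)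
    also have "((\<phi> Y $ 1 * force Y (\<psi> Y) (\<upsilon> Y) $ 1 + slope Y (\<phi> Y) (\<tau> Y) $ 1 * \<upsilon> Y $ 1)
       + (\<phi> Y $ 2 * force Y (\<psi> Y) (\<upsilon> Y) $ 2 + slope Y (\<phi> Y) (\<tau> Y) $ 2 * \<upsilon> Y $ 2)
       - (\<psi> Y $ 1 * force Y (\<phi> Y) (\<tau> Y) $ 1 + slope Y (\<psi> Y) (\<upsilon> Y) $ 1 * \<tau> Y $ 1)
       - (\<psi> Y $ 2 * force Y (\<phi> Y) (\<tau> Y) $ 2 + slope Y (\<psi> Y) (\<upsilon> Y) $ 2 * \<tau> Y $ 2)) = 0"
      by (simp add: force_def tr[where x = "\<phi> Y" and t = "\<tau> Y"] tr[where x = "\<psi> Y" and t = "\<upsilon> Y"] algebra_simps)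
    finally show ?thesis .
  qed
  then show ?thesis
    using has_vector_derivative_zero_constant[OF \<open>convex S\<close>, of "\<lambda>Z. wronskian (\<phi> Z) (\<tau> Z) (\<psi> Z) (\<upsilon> Z)"]
      assms(5,6) by metis
qed

end

subsection \<open>Boundary values at the free surface\<close>

lemma norm_vec2_le: "norm (x :: 'a::real_normed_vector^2) \<le> norm (x $ 1) + norm (x $ 2)"
  using norm_le_l1_cart[of "\<chi> i. norm (x $ i)"] by (simp add: norm_vec_def sum_2)

lemma column_matrix_mult: "column j (A ** B) = A *v column j B"
  by (simp add: column_def matrix_matrix_mult_def matrix_vector_mult_def vec_eq_iff)

lemma tendsto_columns:
  fixes F :: "'b \<Rightarrow> 'a::topological_space^'m^'n"
  assumes "\<And>j. ((\<lambda>x. column j (F x)) \<longlongrightarrow> column j L) net"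
  shows "(F \<longlongrightarrow> L) net"
proof (intro vec_tendstoI)
  fix i j
  show "((\<lambda>x. F x $ i $ j) \<longlongrightarrow> L $ i $ j) net"
    using tendsto_vec_nth[OF assms[of j], of i] by (simp add: column_def)
qed

lemma tendsto_column:
  assumes "(F \<longlongrightarrow> L) net"
  shows "((\<lambda>x. column j (F x)) \<longlongrightarrow> column j L) net"
  unfolding column_def by (intro tendsto_vec_lambda tendsto_vec_nth assms)

lemma has_vector_derivative_columns:
  fixes F :: "real \<Rightarrow> 'a::real_normed_vector^'m^'n"
  assumes "\<And>j. ((\<lambda>x. column j (F x)) has_vector_derivative column j F') (at x within S)"
  shows "(F has_vector_derivative F') (at x within S)"
  using assms by (simp add: has_vector_derivative_vec_iff column_def)

context elastic_half_line
begin

text \<open>This is the growth bound required by \<open>linear_growth_ode_has_limit\<close>. The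
  coefficients are continuous on a compact interval that includes the surface, and the denominators
  do not vanish there.\<close>

lemma slope_force_bounded:
  assumes "c < 0"
  shows "\<exists>K. \<forall>Z\<in>{c..0}. \<forall>x t. norm (slope Z x t, force Z x t) \<le> K * norm (x, t)"
proof -
  \<comment> \<open>\<open>k\<close> adds up the coefficients bounding both components of
    \<open>slope\<close>. In \<open>l\<close>, which does so for \<open>force\<close>, the slope is
    replaced by its bound \<open>k\<close>, and each component contributes one
    \<open>\<omega>\<^sup>2\<close>.\<close>
  define k where "k Z = 1 / mu Z + cmod \<xi> + (1 + cmod \<xi> * \<bar>lam Z\<bar>) / (lam Z + 2 * mu Z)" for Z
  define l where "l Z = cmod \<xi> * (\<bar>lam Z\<bar> + mu Z) * k Z + 2 * \<omega>\<^sup>2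
      + (cmod \<xi>)\<^sup>2 * ((lam Z + 2 * mu Z) + mu Z)" for Z
  have "continuous_on {c..0} (\<lambda>Z. k Z + l Z)"
  proof -
    have c: "continuous_on {c..0} lam" "continuous_on {c..0} mu"
      using lam_cont mu_cont by (auto intro: continuous_on_subset)
    have "mu Z \<noteq> 0" "lam Z + 2 * mu Z \<noteq> 0" if "Z \<in> {c..0}" for Z
      using mu_pos[of Z] sigma_pos[of Z] that by auto
    then show ?thesis
      unfolding l_def k_def by (intro continuous_intros c) auto
  qed
  then obtain K where K: "k Z + l Z \<le> K" if "Z \<in> {c..0}" for Z
    using continuous_attains_sup[of "{c..0}" "\<lambda>Z. k Z + l Z"] \<open>c < 0\<close> by force
  have "norm (slope Z x t, force Z x t) \<le> 2 * K * norm (x, t)" if Z: "Z \<in> {c..0}" for Z x t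
  proof -
    define N where "N = norm (x, t)"
    have pos: "mu Z > 0" "lam Z + 2 * mu Z > 0"
      using mu_pos[of Z] sigma_pos[of Z] Z by auto
    have k0: "k Z \<ge> 0" unfolding k_def using pos by simp
    have l0: "l Z \<ge> 0" unfolding l_def using pos k0 by simp
    have N0: "N \<ge> 0" by (simp add: N_def)
    have x: "cmod (x $ i) \<le> N" and t: "cmod (t $ i) \<le> N" for i
      unfolding N_def
      by (rule order_trans[OF Finite_Cartesian_Product.norm_nth_le], rule norm_fst_le norm_snd_le)+
    have n\<sigma>: "cmod (complex_of_real (lam Z + 2 * mu Z)) = lam Z + 2 * mu Z"
      using pos by (simp only: norm_of_real)
    have n\<omega>: "cmod (complex_of_real (\<omega>\<^sup>2)) = \<omega>\<^sup>2"
      by (simp add: norm_power)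
    have n\<mu>: "cmod (complex_of_real (mu Z)) = mu Z"
      using pos by simp
    have "cmod (slope Z x t $ 1) \<le> cmod (t $ 1) / mu Z + cmod \<xi> * cmod (x $ 2)"
      unfolding slope_def vector_2
      by (rule order_trans[OF norm_triangle_ineq]) (simp only: norm_mult norm_divide n\<mu>)
    also have "\<dots> \<le> N / mu Z + cmod \<xi> * N"
      using x t pos by (intro add_mono divide_right_mono mult_left_mono) auto
    finally have s1: "cmod (slope Z x t $ 1) \<le> N / mu Z + cmod \<xi> * N" .
    have "cmod (slope Z x t $ 2) \<le> (cmod (t $ 2) + cmod \<xi> * \<bar>lam Z\<bar> * cmod (x $ 1)) / (lam Z + 2 * mu Z)"
      unfolding slope_def vector_2 norm_divide n\<sigma> using pos
      by (intro divide_right_mono order_trans[OF norm_triangle_ineq4]) (auto simp: norm_mult)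
    also have "\<dots> \<le> (N + cmod \<xi> * \<bar>lam Z\<bar> * N) / (lam Z + 2 * mu Z)"
      using x t pos by (intro add_mono divide_right_mono mult_left_mono) auto
    finally have s2: "cmod (slope Z x t $ 2) \<le> (N + cmod \<xi> * \<bar>lam Z\<bar> * N) / (lam Z + 2 * mu Z)" .
    have k_eq: "k Z * N = (N / mu Z + cmod \<xi> * N) + (N + cmod \<xi> * \<bar>lam Z\<bar> * N) / (lam Z + 2 * mu Z)"
      by (simp add: k_def algebra_simps add_divide_distrib)
    have "0 \<le> N / mu Z + cmod \<xi> * N" "0 \<le> (N + cmod \<xi> * \<bar>lam Z\<bar> * N) / (lam Z + 2 * mu Z)"
      using pos N0 by auto
    then have s1k: "cmod (slope Z x t $ 1) \<le> k Z * N" and s2k: "cmod (slope Z x t $ 2) \<le> k Z * N"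
      using s1 s2 k_eq by linarith+
    have ns: "norm (slope Z x t) \<le> k Z * N"
      using norm_vec2_le[of "slope Z x t"] s1 s2 k_eq by linarith
    have "cmod (force Z x t $ 1) \<le> cmod \<xi> * \<bar>lam Z\<bar> * cmod (slope Z x t $ 2)
        + (\<omega>\<^sup>2 + (cmod \<xi>)\<^sup>2 * (lam Z + 2 * mu Z)) * cmod (x $ 1)"
    proof -
      have "cmod (of_real (\<omega>\<^sup>2) - \<xi>\<^sup>2 * of_real (lam Z + 2 * mu Z)) \<le> \<omega>\<^sup>2 + (cmod \<xi>)\<^sup>2 * (lam Z + 2 * mu Z)"
        by (rule order_trans[OF norm_triangle_ineq4])
           (simp only: norm_mult n\<sigma> norm_power n\<omega> order_refl)
      then show ?thesis
        unfolding force_def vector_2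
        by (intro order_trans[OF norm_triangle_ineq4] add_mono)
           (auto simp: norm_mult intro: mult_right_mono)
    qed
    also have "\<dots> \<le> cmod \<xi> * \<bar>lam Z\<bar> * (k Z * N) + (\<omega>\<^sup>2 + (cmod \<xi>)\<^sup>2 * (lam Z + 2 * mu Z)) * N"
      using x s2k pos by (intro add_mono mult_left_mono) auto
    finally have f1: "cmod (force Z x t $ 1) \<le> cmod \<xi> * \<bar>lam Z\<bar> * (k Z * N)
        + (\<omega>\<^sup>2 + (cmod \<xi>)\<^sup>2 * (lam Z + 2 * mu Z)) * N" .
    have "cmod (force Z x t $ 2) \<le> cmod \<xi> * mu Z * cmod (slope Z x t $ 1)
        + (\<omega>\<^sup>2 + (cmod \<xi>)\<^sup>2 * mu Z) * cmod (x $ 2)"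
    proof -
      have "cmod (of_real (\<omega>\<^sup>2) - \<xi>\<^sup>2 * of_real (mu Z)) \<le> \<omega>\<^sup>2 + (cmod \<xi>)\<^sup>2 * mu Z"
        by (rule order_trans[OF norm_triangle_ineq4])
           (simp only: norm_mult n\<mu> norm_power n\<omega> order_refl)
      then show ?thesis
        unfolding force_def vector_2 using pos
        by (intro order_trans[OF norm_triangle_ineq4] add_mono)
           (auto simp: norm_mult intro: mult_right_mono)
    qed
    also have "\<dots> \<le> cmod \<xi> * mu Z * (k Z * N) + (\<omega>\<^sup>2 + (cmod \<xi>)\<^sup>2 * mu Z) * N"
      using x s1k pos by (intro add_mono mult_left_mono) auto
    finally have f2: "cmod (force Z x t $ 2) \<le> cmod \<xi> * mu Z * (k Z * N)
        + (\<omega>\<^sup>2 + (cmod \<xi>)\<^sup>2 * mu Z) * N" .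
    have "l Z * N = (cmod \<xi> * \<bar>lam Z\<bar> * (k Z * N) + (\<omega>\<^sup>2 + (cmod \<xi>)\<^sup>2 * (lam Z + 2 * mu Z)) * N)
       + (cmod \<xi> * mu Z * (k Z * N) + (\<omega>\<^sup>2 + (cmod \<xi>)\<^sup>2 * mu Z) * N)"
      by (simp add: l_def algebra_simps)
    then have nf: "norm (force Z x t) \<le> l Z * N"
      using norm_vec2_le[of "force Z x t"] f1 f2 by linarith
    have "norm (slope Z x t, force Z x t) \<le> norm (slope Z x t) + norm (force Z x t)"
      by (rule norm_Pair_le)
    also have "\<dots> \<le> (k Z + l Z) * N"
      using ns nf by (simp add: algebra_simps)
    also have "\<dots> \<le> K * N"
      using K[OF Z] N0 by (rule mult_right_mono)
    also have "\<dots> \<le> 2 * K * N"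
      using K[OF Z] k0 l0 N0 by simp
    finally show ?thesis by (simp add: N_def)
  qed
  then show ?thesis by blast
qed

text \<open>\<open>at0m\<close> is a total \<open>Lim\<close>, so \<open>a_hat\<close> and
  \<open>b_hat\<close> can be evaluated only after the limits are known to exist. Position and
  traction are treated as one function, since each enters the derivative of the other.\<close>

lemma state_has_limits:
  assumes "c < 0" "state {c<..<0} \<phi> \<tau>"
  obtains l m where "(\<phi> \<longlongrightarrow> l) (at_left 0)" "(\<tau> \<longlongrightarrow> m) (at_left 0)"
proof -
  obtain K where K: "norm (slope Z x t, force Z x t) \<le> K * norm (x, t)" if "Z \<in> {c..0}" for Z x t
    using slope_force_bounded[OF \<open>c < 0\<close>] by blast
  have "\<exists>l. ((\<lambda>Z. (\<phi> Z, \<tau> Z)) \<longlongrightarrow> l) (at_left 0)"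
  proof (rule linear_growth_ode_has_limit[OF \<open>c < 0\<close>])
    fix Z assume "c < Z" "Z < 0"
    then show "((\<lambda>Z. (\<phi> Z, \<tau> Z)) has_vector_derivative
        (slope Z (\<phi> Z) (\<tau> Z), force Z (\<phi> Z) (\<tau> Z))) (at Z)"
      using assms(2) by (auto simp: state_def intro: has_vector_derivative_Pair)
    show "norm (slope Z (\<phi> Z) (\<tau> Z), force Z (\<phi> Z) (\<tau> Z)) \<le> K * norm (\<phi> Z, \<tau> Z)"
      using \<open>c < Z\<close> \<open>Z < 0\<close> by (intro K) auto
  qed
  then obtain l where "((\<lambda>Z. (\<phi> Z, \<tau> Z)) \<longlongrightarrow> l) (at_left 0)" ..
  from tendsto_fst[OF this] tendsto_snd[OF this] show ?thesis
    by (intro that) auto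
qed

lemma coefficients_at_left:
  "(lam \<longlongrightarrow> lam 0) (at_left 0)" "(mu \<longlongrightarrow> mu 0) (at_left 0)"
proof -
  have "(f \<longlongrightarrow> f 0) (at_left 0)" if "continuous_on {..0} f" for f :: "real \<Rightarrow> real"
    by (rule tendsto_within_subset[where S = "{..0}"])
      (use that in \<open>auto simp: continuous_on_def\<close>)
  then show "(lam \<longlongrightarrow> lam 0) (at_left 0)" "(mu \<longlongrightarrow> mu 0) (at_left 0)"
    using lam_cont mu_cont by auto
qed

text \<open>If \<open>m\<close> is the limit of \<tau>, then \<open>a_hat\<close> is
  \<open>\<i> * m $ 2\<close> and \<open>b_hat\<close> is \<open>m $ 1\<close>.\<close>

lemma traction_free_iff:
  assumes "c < 0" "state {c<..<0} \<phi> \<tau>"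
  shows "traction_free lam mu \<xi> \<phi> \<longleftrightarrow> (\<tau> \<longlongrightarrow> 0) (at_left 0)"
proof -
  obtain l m where l: "(\<phi> \<longlongrightarrow> l) (at_left 0)" and m: "(\<tau> \<longlongrightarrow> m) (at_left 0)"
    using state_has_limits[OF assms] by blast
  note nz = coefficients_nonzero[OF order_refl]
  have \<phi>0: "at0m (\<lambda>Z. \<phi> Z $ i) = l $ i" for i
    by (intro tendsto_Lim tendsto_vec_nth l) simp
  have sl: "((\<lambda>Z. slope Z (\<phi> Z) (\<tau> Z)) \<longlongrightarrow> slope 0 l m) (at_left 0)"
    unfolding tendsto_vec2_iff slope_def vector_2
    by (intro conjI tendsto_intros l m coefficients_at_left nz)
  have "eventually (\<lambda>Z. slope Z (\<phi> Z) (\<tau> Z) = ddz \<phi> Z) (at_left 0)"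
    unfolding eventually_at_left_field using assms state_ddz[OF assms(2)] by (intro exI[of _ c]) auto
  then have "((\<lambda>Z. ddz \<phi> Z) \<longlongrightarrow> slope 0 l m) (at_left 0)"
    using sl by (rule Lim_transform_eventually[rotated])
  then have d\<phi>0: "at0m (\<lambda>Z. ddz \<phi> Z $ i) = slope 0 l m $ i" for i
    by (intro tendsto_Lim tendsto_vec_nth) simp_all
  have coef: "at0m lam = lam 0" "at0m mu = mu 0"
    by (intro tendsto_Lim coefficients_at_left; simp)+
  have "a_hat lam mu \<xi> \<phi> = \<i> * m $ 2" "b_hat lam mu \<xi> \<phi> = m $ 1"
    using nz unfolding a_hat_def b_hat_def coef \<phi>0 d\<phi>0 slope_def vector_2
    by (simp_all add: field_simps)
  then have "traction_free lam mu \<xi> \<phi> \<longleftrightarrow> m = 0"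
    by (auto simp: traction_free_def vec2_eq_iff)
  also have "\<dots> \<longleftrightarrow> (\<tau> \<longlongrightarrow> 0) (at_left 0)"
    using m tendsto_unique[of "at_left (0::real)"] by auto
  finally show ?thesis .
qed

text \<open>Traction-free states at the surface form a Lagrangian subspace: the form vanishes in the
  limit at 0, and being constant it vanishes throughout.\<close>

lemma wronskian_traction_free:
  assumes "c < 0" "state {c<..<0} \<phi> \<tau>" "state {c<..<0} \<psi> \<upsilon>"
    and "traction_free lam mu \<xi> \<phi>" "traction_free lam mu \<xi> \<psi>" and Z: "Z \<in> {c<..<0}"
  shows "wronskian (\<phi> Z) (\<tau> Z) (\<psi> Z) (\<upsilon> Z) = 0"
proof -
  obtain l m where l: "(\<phi> \<longlongrightarrow> l) (at_left 0)" "(\<psi> \<longlongrightarrow> m) (at_left 0)"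
    using state_has_limits[OF assms(1,2)] state_has_limits[OF assms(1,3)] by metis
  have t: "(\<tau> \<longlongrightarrow> 0) (at_left 0)" "(\<upsilon> \<longlongrightarrow> 0) (at_left 0)"
    using traction_free_iff[OF assms(1,2)] traction_free_iff[OF assms(1,3)] assms(4,5) by auto
  have sub: "{c<..<0} \<subseteq> {..<0}" by auto
  have "eventually (\<lambda>Y. wronskian (\<phi> Y) (\<tau> Y) (\<psi> Y) (\<upsilon> Y) = wronskian (\<phi> Z) (\<tau> Z) (\<psi> Z) (\<upsilon> Z)) (at_left 0)"
    unfolding eventually_at_left_field using assms(1)
      wronskian_constant[OF assms(2,3) convex_real_interval(8) sub _ Z] by (intro exI[of _ c]) auto
  then have "((\<lambda>_ :: real. wronskian (\<phi> Z) (\<tau> Z) (\<psi> Z) (\<upsilon> Z)) \<longlongrightarrow> wronskian l 0 m 0) (at_left 0)"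
    by (rule Lim_transform_eventually[OF tendsto_wronskian[OF l(1) t(1) l(2) t(2)]])
  then show ?thesis
    by (simp add: tendsto_const_iff wronskian_def)
qed

text \<open>Translates the matrix \<open>P G'\<close> of the jump condition into tractions of
  columns. The extra term is continuous wherever \<open>F\<close> is, so both jump by the same
  amount.\<close>

lemma column_P_ddz:
  assumes "\<And>j. state S (\<lambda>z. column j (F z)) (\<tau> j)" "Z \<in> S" "Z \<le> 0"
  shows "column j (P_mat lam mu Z ** ddz F Z) = \<tau> j Z + \<xi> *s (transpose (N_mat lam mu Z) *v column j (F Z))"
proof -
  have "(F has_vector_derivative (\<chi> i j. slope Z (column j (F Z)) (\<tau> j Z) $ i)) (at Z)"
  proof (rule has_vector_derivative_columns)
    fix j
    have "column j (\<chi> i j. slope Z (column j (F Z)) (\<tau> j Z) $ i) = slope Z (column j (F Z)) (\<tau> j Z)"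
      by (simp add: column_def vec_eq_iff)
    then show "((\<lambda>z. column j (F z)) has_vector_derivative
        column j (\<chi> i j. slope Z (column j (F Z)) (\<tau> j Z) $ i)) (at Z)"
      using assms(1,2) by (simp add: state_def)
  qed
  then have "column j (ddz F Z) = slope Z (column j (F Z)) (\<tau> j Z)"
    by (simp add: vector_derivative_at column_def vec_eq_iff)
  then show ?thesis
    using P_slope[OF assms(3)] by (simp add: column_matrix_mult)
qed

lemma tendsto_transpose_N:
  assumes "Y < 0" "(\<phi> \<longlongrightarrow> l) (at Y within T)"
  shows "((\<lambda>Z. transpose (N_mat lam mu Z) *v \<phi> Z) \<longlongrightarrow> transpose (N_mat lam mu Y) *v l) (at Y within T)"
proof -
  have "isCont lam Y" "isCont mu Y"
    using lam_diff mu_diff assms(1) by (auto intro: differentiable_imp_continuous_within)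
  then have "(lam \<longlongrightarrow> lam Y) (at Y within T)" "(mu \<longlongrightarrow> mu Y) (at Y within T)"
    by (auto simp: isCont_def intro: tendsto_within_subset)
  then show ?thesis
    unfolding coefficient_matrix_mult tendsto_vec2_iff vector_2
    by (intro conjI tendsto_intros assms(2))
qed

end

subsection \<open>Green's functions from a symplectic basis\<close>

text \<open>\<open>p, s\<close> play the role of \<open>\<psi>\<^sub>P\<^sup>-, \<psi>\<^sub>S\<^sup>-\<close> and \<open>g, h\<close> that of \<open>g\<^sub>P\<^sup>+, g\<^sub>S\<^sup>+\<close>.\<close>

locale elastic_green = elastic_half_line +
  fixes p s g h tp ts tg th :: "real \<Rightarrow> complex^2" and a b :: complex
  assumes p: "state {..<0} p tp" and s: "state {..<0} s ts"
    and g: "state {..<0} g tg" and h: "state {..<0} h th"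
    and ps: "\<And>Z. Z < 0 \<Longrightarrow> wronskian (p Z) (tp Z) (s Z) (ts Z) = 0"
    and ph: "\<And>Z. Z < 0 \<Longrightarrow> wronskian (p Z) (tp Z) (h Z) (th Z) = 0"
    and sg: "\<And>Z. Z < 0 \<Longrightarrow> wronskian (s Z) (ts Z) (g Z) (tg Z) = 0"
    and pg: "\<And>Z. Z < 0 \<Longrightarrow> wronskian (p Z) (tp Z) (g Z) (tg Z) = a"
    and sh: "\<And>Z. Z < 0 \<Longrightarrow> wronskian (s Z) (ts Z) (h Z) (th Z) = b"
    and nonzero: "a \<noteq> 0" "b \<noteq> 0"
    and traction_free: "traction_free lam mu \<xi> g" "traction_free lam mu \<xi> h"
    and decay: "(p \<longlongrightarrow> 0) at_bot" "(s \<longlongrightarrow> 0) at_bot"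
    and no_decay: "\<And>c d. ((\<lambda>Z. c *s g Z + d *s h Z) \<longlongrightarrow> 0) at_bot \<Longrightarrow> c = 0 \<and> d = 0"
begin

lemma gh: "Z < 0 \<Longrightarrow> wronskian (g Z) (tg Z) (h Z) (th Z) = 0"
  \<comment> \<open>Any left endpoint below \<open>Z\<close> serves; \<open>Z - 1\<close> is
    one.\<close>
  by (rule wronskian_traction_free[of "Z - 1"])
     (auto intro: state_subset[OF g] state_subset[OF h] traction_free)

lemmas expansion = symplectic_basis_expansion[OF ps gh ph sg pg sh nonzero]

text \<open>Column \<open>j\<close> of the kernel below and above the source, with tractions. The
  coefficients are source values of the partner solutions; for
  \<open>a = 2 \<i> \<omega>\<^sup>2 qP\<close> and \<open>b = 2 \<i> \<omega>\<^sup>2 qS\<close>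
  these are the two branches of the formula.\<close>

definition lcol where "lcol Z' j Z = (g Z' $ j / a) *s p Z + (h Z' $ j / b) *s s Z"
definition ltrac where "ltrac Z' j Z = (g Z' $ j / a) *s tp Z + (h Z' $ j / b) *s ts Z"
definition rcol where "rcol Z' j Z = (p Z' $ j / a) *s g Z + (s Z' $ j / b) *s h Z"
definition rtrac where "rtrac Z' j Z = (p Z' $ j / a) *s tg Z + (s Z' $ j / b) *s th Z"

lemma state_lcol: "state {..<0} (lcol Z' j) (ltrac Z' j)"
  unfolding lcol_def ltrac_def by (intro state_add state_smult p s)

lemma state_rcol: "state {..<0} (rcol Z' j) (rtrac Z' j)"
  unfolding rcol_def rtrac_def by (intro state_add state_smult g h)

text \<open>The position half of the expansion of (0, e_j); the traction half is
  \<open>trac_jump\<close>.\<close>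

lemma col_continuous:
  assumes "Z' < 0" shows "rcol Z' j Z' = lcol Z' j Z'"
  using expansion(1)[OF assms assms assms assms assms assms, of 0 "axis j 1"]
  by (simp add: wronskian_axis lcol_def rcol_def vec2_eq_iff algebra_simps)

lemma trac_jump:
  assumes "Z' < 0" shows "rtrac Z' j Z' - ltrac Z' j Z' = axis j 1"
  \<comment> \<open>Here \<open>t\<close> occurs before \<open>x\<close> in the rule, so the
    arguments come in the opposite order to those of \<open>expansion(1)\<close>.\<close>
  using expansion(2)[OF assms assms assms assms assms assms, of "axis j 1" 0]
  by (simp add: wronskian_axis ltrac_def rtrac_def algebra_simps)

text \<open>At \<open>Z = Z'\<close> the right branch is taken; by \<open>col_continuous\<close> the
  left one gives the same value.\<close>

definition kernel :: "real \<Rightarrow> real \<Rightarrow> complex^2^2" where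
  "kernel Z Z' = (if Z < Z' then \<chi> i j. lcol Z' j Z $ i else \<chi> i j. rcol Z' j Z $ i)"

lemma column_kernel: "column j (kernel Z Z') = (if Z < Z' then lcol Z' j Z else rcol Z' j Z)"
  by (simp add: kernel_def column_def vec_eq_iff)

lemma state_kernel_left:
  assumes "Z' < 0" shows "state {..<Z'} (\<lambda>Z. column j (kernel Z Z')) (ltrac Z' j)"
  by (rule state_cong[OF state_subset[OF state_lcol]]) (use assms in \<open>auto simp: column_kernel\<close>)

lemma state_kernel_right:
  "state {Z'<..<0} (\<lambda>Z. column j (kernel Z Z')) (rtrac Z' j)"
  by (rule state_cong[OF state_subset[OF state_rcol]]) (auto simp: column_kernel)

text \<open>Both branches solve the equation; the right one inherits the boundary condition from
  \<open>g, h\<close>, the left one decay from \<open>p, s\<close>. The source conditions are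
  \<open>col_continuous\<close> and \<open>trac_jump\<close>.\<close>

lemma greens_function_kernel: "greens_function \<omega> lam mu \<xi> kernel"
  unfolding greens_function_def
proof (intro allI impI)
  fix Z' :: real assume Z': "Z' < 0"
  let ?K = "\<lambda>Z. kernel Z Z'"
  note ev = eventually_left_right[OF Z']
  have cont: "(lcol Z' j \<longlongrightarrow> lcol Z' j Z') (at Z' within S)" "(rcol Z' j \<longlongrightarrow> lcol Z' j Z') (at Z' within S)"
    "(ltrac Z' j \<longlongrightarrow> ltrac Z' j Z') (at Z' within S)" "(rtrac Z' j \<longlongrightarrow> rtrac Z' j Z') (at Z' within S)" for j S
    using state_continuous[OF state_lcol, of Z' Z' j] state_continuous[OF state_rcol, of Z' Z' j] Z'
      col_continuous[OF Z', of j]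
    by (auto simp: isCont_def intro: tendsto_within_subset)
  have "rayleigh_solution \<omega> lam mu \<xi> ({..<0} - {Z'}) (\<lambda>Z. column j (?K Z))" for j
  proof -
    have "rayleigh_solution \<omega> lam mu \<xi> {..<Z'} (\<lambda>Z. column j (?K Z))"
         "rayleigh_solution \<omega> lam mu \<xi> {Z'<..<0} (\<lambda>Z. column j (?K Z))"
      using state_kernel_left[OF Z'] state_kernel_right Z'
      by (auto intro!: state_imp_rayleigh_solution)
    then show ?thesis
      unfolding rayleigh_solution_def by (auto simp: neq_iff)
  qed
  moreover have "isCont ?K Z'"
  proof -
    have colK: "column j (?K Z') = lcol Z' j Z'" for j
      by (simp add: column_kernel col_continuous[OF Z'])
    have "((\<lambda>Z. column j (?K Z)) \<longlongrightarrow> column j (?K Z')) (at_left Z')" for j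
      unfolding colK using cont(1)[of j "{..<Z'}"] ev(1)
      by (rule Lim_transform_eventually[OF _ eventually_mono]) (simp add: column_kernel)
    moreover have "((\<lambda>Z. column j (?K Z)) \<longlongrightarrow> column j (?K Z')) (at_right Z')" for j
      unfolding colK using cont(2)[of j "{Z'<..}"] ev(2)
      by (rule Lim_transform_eventually[OF _ eventually_mono]) (simp add: column_kernel)
    ultimately show ?thesis
      unfolding isCont_def filterlim_at_split by (blast intro: tendsto_columns)
  qed
  moreover have "\<exists>Tl Tr. ((\<lambda>Z. P_mat lam mu Z ** ddz ?K Z) \<longlongrightarrow> Tl) (at_left Z') \<and>
      ((\<lambda>Z. P_mat lam mu Z ** ddz ?K Z) \<longlongrightarrow> Tr) (at_right Z') \<and> Tr - Tl = mat 1"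
  proof (intro exI conjI)
    \<comment> \<open>Both one-sided limits of \<open>P G'\<close> contain the same
      \<open>transpose N\<close> term, so their difference is the traction jump.\<close>
    let ?l = "\<lambda>j. ltrac Z' j Z' + \<xi> *s (transpose (N_mat lam mu Z') *v lcol Z' j Z')"
    let ?r = "\<lambda>j. rtrac Z' j Z' + \<xi> *s (transpose (N_mat lam mu Z') *v lcol Z' j Z')"
    have colM: "column j (\<chi> i j. f j $ i) = f j" for f :: "2 \<Rightarrow> complex^2" and j
      by (simp add: column_def vec_eq_iff)
    show "((\<lambda>Z. P_mat lam mu Z ** ddz ?K Z) \<longlongrightarrow> (\<chi> i j. ?l j $ i)) (at_left Z')"
    proof (rule tendsto_columns, unfold colM)
      fix j
      have "((\<lambda>Z. ltrac Z' j Z + \<xi> *s (transpose (N_mat lam mu Z) *v lcol Z' j Z)) \<longlongrightarrow> ?l j) (at_left Z')"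
        by (intro tendsto_add tendsto_smult tendsto_transpose_N Z' cont)
      then show "((\<lambda>Z. column j (P_mat lam mu Z ** ddz ?K Z)) \<longlongrightarrow> ?l j) (at_left Z')"
        using ev(1) by (rule Lim_transform_eventually[OF _ eventually_mono])
          (use Z' column_P_ddz[OF state_kernel_left[OF Z']] in \<open>simp add: column_kernel\<close>)
    qed
    show "((\<lambda>Z. P_mat lam mu Z ** ddz ?K Z) \<longlongrightarrow> (\<chi> i j. ?r j $ i)) (at_right Z')"
    proof (rule tendsto_columns, unfold colM)
      fix j
      have "((\<lambda>Z. rtrac Z' j Z + \<xi> *s (transpose (N_mat lam mu Z) *v rcol Z' j Z)) \<longlongrightarrow> ?r j) (at_right Z')"
        by (intro tendsto_add tendsto_smult tendsto_transpose_N Z' cont)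
      then show "((\<lambda>Z. column j (P_mat lam mu Z ** ddz ?K Z)) \<longlongrightarrow> ?r j) (at_right Z')"
        using ev(2) by (rule Lim_transform_eventually[OF _ eventually_mono])
          (use Z' column_P_ddz[OF state_kernel_right] in \<open>simp add: column_kernel\<close>)
    qed
    have "(rtrac Z' j Z' - ltrac Z' j Z') $ i = mat 1 $ i $ j" for i j
      using trac_jump[OF Z', of j] by (simp add: axis_def mat_def)
    then show "(\<chi> i j. ?r j $ i) - (\<chi> i j. ?l j $ i) = mat 1"
      by (simp add: vec_eq_iff)
  qed
  moreover have "traction_free lam mu \<xi> (\<lambda>Z. column j (?K Z))" for j
  proof -
    have "{-1<..<0} \<subseteq> {..<0::real}" by auto
    then have "(tg \<longlongrightarrow> 0) (at_left 0)" "(th \<longlongrightarrow> 0) (at_left 0)"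
      using traction_free traction_free_iff[of "-1", OF _ state_subset[OF g]]
        traction_free_iff[of "-1", OF _ state_subset[OF h]] by auto
    then have "(rtrac Z' j \<longlongrightarrow> (p Z' $ j / a) *s 0 + (s Z' $ j / b) *s 0) (at_left 0)"
      unfolding rtrac_def by (intro tendsto_add tendsto_smult)
    then show ?thesis
      using traction_free_iff[OF Z' state_kernel_right] by simp
  qed
  moreover have "(?K \<longlongrightarrow> 0) at_bot"
  proof (rule tendsto_columns)
    fix j
    have "(lcol Z' j \<longlongrightarrow> (g Z' $ j / a) *s 0 + (h Z' $ j / b) *s 0) at_bot"
      unfolding lcol_def by (intro tendsto_add tendsto_smult decay)
    moreover have "column j (0 :: complex^2^2) = 0"
      by (simp add: column_def vec_eq_iff)
    ultimately have "(lcol Z' j \<longlongrightarrow> column j 0) at_bot" by simp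
    then show "((\<lambda>Z. column j (?K Z)) \<longlongrightarrow> column j 0) at_bot"
      using eventually_gt_at_bot[of Z']
      by (rule Lim_transform_eventually[OF _ eventually_mono]) (simp add: column_kernel)
  qed
  ultimately show "(\<forall>j. rayleigh_solution \<omega> lam mu \<xi> ({..<0} - {Z'}) (\<lambda>Z. column j (kernel Z Z'))) \<and>
        isCont ?K Z' \<and>
        (\<exists>Tl Tr.
           ((\<lambda>Z. P_mat lam mu Z ** ddz ?K Z) \<longlongrightarrow> Tl) (at_left Z') \<and>
           ((\<lambda>Z. P_mat lam mu Z ** ddz ?K Z) \<longlongrightarrow> Tr) (at_right Z') \<and>
           Tr - Tl = mat 1) \<and>
        (\<forall>j. traction_free lam mu \<xi> (\<lambda>Z. column j (kernel Z Z'))) \<and> (?K \<longlongrightarrow> 0) at_bot"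
    by blast
qed

text \<open>\<open>greens_function\<close> is a property, so the formula has to be derived for every
  \<open>G\<close> having it. The four pairings of a column with the basis solutions are computed on
  each side and inserted into \<open>expansion\<close>.\<close>

lemma greens_function_unique:
  assumes G: "greens_function \<omega> lam mu \<xi> G" and Z': "Z' < 0"
  shows "Z < Z' \<Longrightarrow> column j (G Z Z') = lcol Z' j Z"
    and "Z' < Z \<Longrightarrow> Z < 0 \<Longrightarrow> column j (G Z Z') = rcol Z' j Z"
proof -
  define u where "u j Z = column j (G Z Z')" for j Z
  define v where "v j = trac (u j)" for j
  from G Z' obtain Tl Tr where
    sol: "\<And>j. rayleigh_solution \<omega> lam mu \<xi> ({..<0} - {Z'}) (u j)"
    and cont: "isCont (\<lambda>Z. G Z Z') Z'"
    and Tl: "((\<lambda>Z. P_mat lam mu Z ** ddz (\<lambda>z. G z Z') Z) \<longlongrightarrow> Tl) (at_left Z')"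
    and Tr: "((\<lambda>Z. P_mat lam mu Z ** ddz (\<lambda>z. G z Z') Z) \<longlongrightarrow> Tr) (at_right Z')"
    and jump: "Tr - Tl = mat 1"
    and free: "\<And>j. traction_free lam mu \<xi> (u j)"
    and bot: "((\<lambda>Z. G Z Z') \<longlongrightarrow> 0) at_bot"
    unfolding greens_function_def u_def by blast
  note ev = eventually_left_right[OF Z']
  have st: "state ({..<0} - {Z'}) (u j) (v j)" for j
    using sol[of j] unfolding v_def by (subst (asm) rayleigh_solution_iff_state) auto
  have stl: "state {..<Z'} (u j) (v j)" and str: "state {Z'<..<0} (u j) (v j)" for j
    by (rule state_subset[OF st]; use Z' in auto)+
  have u_lim: "(u j \<longlongrightarrow> u j Z') (at Z' within S)" for j S
    using cont unfolding isCont_def u_def by (intro tendsto_column) (rule tendsto_within_subset, auto)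
  have v_eq: "column j (P_mat lam mu Z ** ddz (\<lambda>z. G z Z') Z) - \<xi> *s (transpose (N_mat lam mu Z) *v u j Z) = v j Z"
    if "Z \<noteq> Z'" "Z < 0" for j Z
    using column_P_ddz[of "{..<0} - {Z'}" "\<lambda>z. G z Z'" v Z j] st[unfolded u_def] that
    by (simp add: u_def)
  \<comment> \<open>The \<open>transpose N\<close> term at the source. By continuity of
    \<open>G\<close> it is the same from both sides, so \<open>v\<close> has the full jump of
    \<open>P G'\<close>.\<close>
  define n where "n j = \<xi> *s (transpose (N_mat lam mu Z') *v u j Z')" for j
  have vl: "(v j \<longlongrightarrow> column j Tl - n j) (at_left Z')" for j
  proof -
    have "((\<lambda>Z. column j (P_mat lam mu Z ** ddz (\<lambda>z. G z Z') Z)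
        - \<xi> *s (transpose (N_mat lam mu Z) *v u j Z)) \<longlongrightarrow> column j Tl - n j) (at_left Z')"
      unfolding n_def
      by (intro tendsto_diff tendsto_smult tendsto_transpose_N tendsto_column Tl Z' u_lim)
    then show ?thesis
      by (rule Lim_transform_eventually[OF _ eventually_mono[OF ev(1)]]) (use Z' v_eq in auto)
  qed
  have vr: "(v j \<longlongrightarrow> column j Tr - n j) (at_right Z')" for j
  proof -
    have "((\<lambda>Z. column j (P_mat lam mu Z ** ddz (\<lambda>z. G z Z') Z)
        - \<xi> *s (transpose (N_mat lam mu Z) *v u j Z)) \<longlongrightarrow> column j Tr - n j) (at_right Z')"
      unfolding n_def
      by (intro tendsto_diff tendsto_smult tendsto_transpose_N tendsto_column Tr Z' u_lim)
    then show ?thesis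
      by (rule Lim_transform_eventually[OF _ eventually_mono[OF ev(2)]]) (use Z' v_eq in auto)
  qed
  have "column j Tr = column j Tl + axis j 1" for j
  proof -
    have "Tr = Tl + mat 1" using jump by (simp add: algebra_simps)
    then show ?thesis by (simp add: vec_eq_iff column_def mat_def axis_def)
  qed
  then have vr': "(v j \<longlongrightarrow> column j Tl - n j + axis j 1) (at_right Z')" for j
    using vr[of j] by (simp add: algebra_simps)
  \<comment> \<open>On each side the pairing is constant, and its one-sided limits at the source
    differ by the pairing with (0, e_j).\<close>
  have w_jump: "wronskian (\<phi> Z2) (\<tau> Z2) (u j Z2) (v j Z2) - wronskian (\<phi> Z1) (\<tau> Z1) (u j Z1) (v j Z1) = \<phi> Z' $ j"
    if \<phi>: "state {..<0} \<phi> \<tau>" and Z1: "Z1 < Z'" and Z2: "Z' < Z2" "Z2 < 0" for \<phi> \<tau> j Z1 Z2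
  proof -
    have \<phi>': "(\<phi> \<longlongrightarrow> \<phi> Z') (at Z' within S)" "(\<tau> \<longlongrightarrow> \<tau> Z') (at Z' within S)" for S
      using state_continuous[OF \<phi>, of Z'] Z' by (auto simp: isCont_def intro: tendsto_within_subset)
    have sub: "{..<Z'} \<subseteq> {..<0}" "{Z'<..<0} \<subseteq> {..<0}" using Z' by auto
    let ?w = "\<lambda>Z. wronskian (\<phi> Z) (\<tau> Z) (u j Z) (v j Z)"
    have const: "Y < Z' \<Longrightarrow> ?w Y = ?w Z1" "Z' < Y \<and> Y < 0 \<Longrightarrow> ?w Y = ?w Z2" for Y
      using wronskian_constant[OF state_subset[OF \<phi> sub(1)] stl _ sub(1), of Y Z1]
        wronskian_constant[OF state_subset[OF \<phi> sub(2)] str _ sub(2), of Y Z2] Z1 Z2 by simp_all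
    have "((\<lambda>_. ?w Z1) \<longlongrightarrow> wronskian (\<phi> Z') (\<tau> Z') (u j Z') (column j Tl - n j)) (at_left Z')"
      by (rule Lim_transform_eventually[OF tendsto_wronskian[OF \<phi>' u_lim vl] eventually_mono[OF ev(1) const(1)]])
    then have 1: "?w Z1 = wronskian (\<phi> Z') (\<tau> Z') (u j Z') (column j Tl - n j)"
      by (simp add: tendsto_const_iff)
    have "((\<lambda>_. ?w Z2) \<longlongrightarrow> wronskian (\<phi> Z') (\<tau> Z') (u j Z') (column j Tl - n j + axis j 1)) (at_right Z')"
      by (rule Lim_transform_eventually[OF tendsto_wronskian[OF \<phi>' u_lim vr'] eventually_mono[OF ev(2) const(2)]])
    then have 2: "?w Z2 = wronskian (\<phi> Z') (\<tau> Z') (u j Z') (column j Tl - n j + axis j 1)"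
      by (simp add: tendsto_const_iff)
    have "wronskian x t y (r + axis j 1) - wronskian x t y r = x $ j" for x t y r :: "complex^2"
      using exhaust_2[of j] by (auto simp: wronskian_def axis_def algebra_simps)
    then show ?thesis unfolding 1 2 .
  qed
  have right: "wronskian (g Z) (tg Z) (u j Z) (v j Z) = 0" "wronskian (h Z) (th Z) (u j Z) (v j Z) = 0"
    if "Z' < Z" "Z < 0" for Z j
  proof -
    have sub: "{Z'<..<0} \<subseteq> {..<0}" by auto
    show "wronskian (g Z) (tg Z) (u j Z) (v j Z) = 0" "wronskian (h Z) (th Z) (u j Z) (v j Z) = 0"
      using wronskian_traction_free[OF Z' state_subset[OF g sub] str traction_free(1) free]
        wronskian_traction_free[OF Z' state_subset[OF h sub] str traction_free(2) free] that
      by simp_all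
  qed
  have left: "wronskian (p Z) (tp Z) (u j Z) (v j Z) = 0 \<and> wronskian (s Z) (ts Z) (u j Z) (v j Z) = 0"
    if "Z < Z'" for Z j
  proof -
    define W where "W \<phi> \<tau> = wronskian (\<phi> Z) (\<tau> Z) (u j Z) (v j Z)" for \<phi> \<tau>
    have sub: "{..<Z'} \<subseteq> {..<0}" using Z' by auto
    have W: "wronskian (\<phi> Y) (\<tau> Y) (u j Y) (v j Y) = W \<phi> \<tau>" if "state {..<0} \<phi> \<tau>" "Y < Z'" for \<phi> \<tau> Y
      using wronskian_constant[OF state_subset[OF that(1) sub] stl _ sub, of Y Z] that(2) \<open>Z < Z'\<close>
      by (simp add: W_def)
    \<comment> \<open>The coefficients of \<open>g, h\<close> in the column are its pairings with
      \<open>p, s\<close>. All terms on the left decay, so the right side does too, and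
      \<open>no_decay\<close> makes these coefficients vanish.\<close>
    have exp: "u j Y - (- (W g tg / a) *s p Y - (W h th / b) *s s Y)
        = (W p tp / a) *s g Y + (W s ts / b) *s h Y" if "Y < Z'" for Y
    proof -
      have Y: "Y < 0" using that Z' by simp
      show ?thesis
        using expansion(1)[OF Y Y Y Y Y Y, of "u j Y" "v j Y"] that
        by (simp add: W p s g h vec2_eq_iff algebra_simps)
    qed
    have "column j (0 :: complex^2^2) = 0" by (simp add: column_def vec_eq_iff)
    then have "(u j \<longlongrightarrow> 0) at_bot"
      using tendsto_column[OF bot, of j] by (simp add: u_def[abs_def])
    then have "((\<lambda>Y. u j Y - (- (W g tg / a) *s p Y - (W h th / b) *s s Y)) \<longlongrightarrow>
        0 - (- (W g tg / a) *s 0 - (W h th / b) *s 0)) at_bot"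
      by (intro tendsto_diff tendsto_smult decay)
    then have "((\<lambda>Y. u j Y - (- (W g tg / a) *s p Y - (W h th / b) *s s Y)) \<longlongrightarrow> 0) at_bot"
      by simp
    then have "((\<lambda>Y. (W p tp / a) *s g Y + (W s ts / b) *s h Y) \<longlongrightarrow> 0) at_bot"
      using eventually_gt_at_bot[of Z']
      by (rule Lim_transform_eventually[OF _ eventually_mono]) (rule exp)
    then show ?thesis
      using no_decay nonzero unfolding W_def by force
  qed
  show "column j (G Z Z') = lcol Z' j Z" if "Z < Z'"
  proof -
    \<comment> \<open>\<open>Z' / 2\<close> is a point between source and surface, where the
      pairings with \<open>g, h\<close> vanish; \<open>w_jump\<close> then gives their values below
      the source.\<close>
    have Z: "Z < 0" and m: "Z' < Z' / 2" "Z' / 2 < 0" using that Z' by auto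
    have "wronskian (g Z) (tg Z) (u j Z) (v j Z) = - g Z' $ j"
         "wronskian (h Z) (th Z) (u j Z) (v j Z) = - h Z' $ j"
      using w_jump[OF g that m, of j] w_jump[OF h that m, of j] unfolding right[OF m]
      by (metis diff_0 minus_minus)+
    then show ?thesis
      using expansion(1)[OF Z Z Z Z Z Z, of "u j Z" "v j Z"] left[OF that, of j]
      by (simp add: lcol_def u_def)
  qed
  show "column j (G Z Z') = rcol Z' j Z" if "Z' < Z" "Z < 0"
  proof -
    have m: "Z' - 1 < Z'" by simp
    have "wronskian (p Z) (tp Z) (u j Z) (v j Z) = p Z' $ j"
         "wronskian (s Z) (ts Z) (u j Z) (v j Z) = s Z' $ j"
      using w_jump[OF p m that, of j] w_jump[OF s m that, of j] left[OF m, of j] by auto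
    then show ?thesis
      using expansion(1)[OF that(2) that(2) that(2) that(2) that(2) that(2), of "u j Z" "v j Z"]
        right[OF that, of j]
      by (simp add: rcol_def u_def)
  qed
qed

end

subsection \<open>Jost solutions\<close>

text \<open>The witness \<open>D 0\<close> agrees with \<open>f\<close> only on \<open>S\<close>, so
  its derivative is transferred within \<open>S\<close>; at interior points this is the full
  derivative.\<close>

lemma C_k_on_imp_differentiable:
  assumes "C_k_on k S f" "k > 0"
  shows "continuous_on S f" "\<And>x. x \<in> interior S \<Longrightarrow> f differentiable (at x)"
proof -
  obtain D where D: "\<And>x. x \<in> S \<Longrightarrow> D 0 x = f x"
    "\<And>x. x \<in> S \<Longrightarrow> (D 0 has_real_derivative D (Suc 0) x) (at x within S)"
    using assms unfolding C_k_on_def by blast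
  have d: "(f has_real_derivative D (Suc 0) x) (at x within S)" if "x \<in> S" for x
    by (rule has_field_derivative_transform_within[OF D(2)[OF that] zero_less_one that]) (simp add: D(1))
  then show "continuous_on S f"
    by (rule DERIV_continuous_on)
  show "f differentiable (at x)" if "x \<in> interior S" for x
  proof -
    have "(f has_real_derivative D (Suc 0) x) (at x within S)"
      using that interior_subset by (intro d) auto
    then show ?thesis
      unfolding at_within_interior[OF that] real_differentiable_def by blast
  qed
qed

lemma exp_ii_tendsto_0:
  assumes "Im q > 0"
  shows "((\<lambda>Z. exp (- \<i> * q * of_real Z)) \<longlongrightarrow> 0) at_bot"
proof -
  have "filterlim (\<lambda>Z. Im q * Z) at_bot at_bot"
    using assms by (intro filterlim_tendsto_pos_mult_at_bot[OF tendsto_const _ filterlim_ident])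
  then have "((\<lambda>Z. exp (Im q * Z)) \<longlongrightarrow> 0) at_bot"
    by (rule filterlim_compose[OF exp_at_bot])
  then have "((\<lambda>Z. norm (exp (- \<i> * q * of_real Z))) \<longlongrightarrow> 0) at_bot"
    by simp
  then show ?thesis
    by (rule tendsto_norm_zero_cancel)
qed

text \<open>Multiplying by the decaying exponential of the opposite sign leaves the constant
  \<open>c\<close>, which must tend to 0.\<close>

lemma growing_exp_tendsto_0D:
  assumes "Im q > 0" "((\<lambda>Z. c * exp (\<i> * q * of_real Z)) \<longlongrightarrow> 0) (at_bot :: real filter)"
  shows "c = 0"
proof -
  have "((\<lambda>Z. c * exp (\<i> * q * of_real Z) * exp (- \<i> * q * of_real Z)) \<longlongrightarrow> 0 * 0) (at_bot :: real filter)"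
    by (intro tendsto_mult assms exp_ii_tendsto_0)
  then have "((\<lambda>Z. c) \<longlongrightarrow> 0) (at_bot :: real filter)"
    by (simp add: mult.assoc mult_exp_exp)
  then show ?thesis
    by (simp add: tendsto_const_iff)
qed

text \<open>If the determinant vanished, then \<open>\<xi>\<^sup>2 = \<omega>\<^sup>2 / (lam0 + 3 * mu0)\<close>, which makes \<open>qP\<close> real.\<close>

lemma physical_sheet_det_nonzero:
  assumes ps: "physical_sheet \<omega> lam0 mu0 \<xi> qP qS"
    and pos: "\<omega> > 0" "mu0 > 0" "lam0 + 2 * mu0 > 0"
  shows "\<xi>\<^sup>2 + qP * qS \<noteq> 0"
proof
  assume "\<xi>\<^sup>2 + qP * qS = 0"
  then have *: "qP * qS = - \<xi>\<^sup>2" by (simp add: eq_neg_iff_add_eq_0 add.commute)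
  define A where "A = \<omega>\<^sup>2 / (lam0 + 2 * mu0)"
  define B where "B = \<omega>\<^sup>2 / mu0"
  have AB: "A > 0" "B > 0" using pos by (simp_all add: A_def B_def)
  have q: "qP\<^sup>2 = of_real A - \<xi>\<^sup>2" "qS\<^sup>2 = of_real B - \<xi>\<^sup>2" "Im qP > 0"
    using ps by (auto simp: physical_sheet_def A_def B_def)
  have "(of_real A - \<xi>\<^sup>2) * (of_real B - \<xi>\<^sup>2) = (\<xi>\<^sup>2)\<^sup>2"
    unfolding q(1,2)[symmetric] using arg_cong[OF *, of "\<lambda>x. x\<^sup>2"] by (simp add: power_mult_distrib)
  then have "\<xi>\<^sup>2 * of_real (A + B) = of_real (A * B)"
    by (simp add: algebra_simps power2_eq_square)
  moreover have "complex_of_real (A + B) \<noteq> 0"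
    using AB by (simp only: of_real_eq_0_iff)
  ultimately have "\<xi>\<^sup>2 = of_real (A * B / (A + B))"
    by (simp add: field_simps)
  then have "qP\<^sup>2 = of_real (A - A * B / (A + B))"
    using q(1) by simp
  also have "A - A * B / (A + B) = A\<^sup>2 / (A + B)"
    using AB by (simp add: field_simps power2_eq_square)
  finally have "qP\<^sup>2 = of_real (A\<^sup>2 / (A + B))" .
  then have "Re (qP\<^sup>2) = A\<^sup>2 / (A + B)" "Im (qP\<^sup>2) = 0"
    by (simp_all only: Re_complex_of_real Im_complex_of_real)
  \<comment> \<open>A vanishing imaginary part of the square forces \<open>Re qP = 0\<close> because
    \<open>Im qP > 0\<close>; then the square is negative, yet it equals a positive number.\<close>
  then have "Re qP = 0" "(Re qP)\<^sup>2 - (Im qP)\<^sup>2 = A\<^sup>2 / (A + B)"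
    using q(3) by (simp_all add: power2_eq_square)
  moreover have "A\<^sup>2 / (A + B) > 0" using AB by simp
  ultimately show False
    using zero_le_power2[of "Im qP"] by simp
qed

context elastic_half_line
begin

text \<open>The traction of the wave \<open>exp (\<kappa> * Z) *s v\<close> for coefficients frozen
  at \<open>Y\<close>, with the exponential removed.\<close>

definition plane_wave_traction :: "real \<Rightarrow> complex^2 \<Rightarrow> complex \<Rightarrow> complex^2" where
  "plane_wave_traction Y v \<kappa> =
     vector [of_real (mu Y) * (\<kappa> * v $ 1 - \<xi> * v $ 2),
             of_real (lam Y + 2 * mu Y) * \<kappa> * v $ 2 + \<xi> * of_real (lam Y) * v $ 1]"

lemma jost_state:
  "jost_solution \<omega> H lam mu \<xi> v \<kappa> \<psi> \<Longrightarrow> state {..<0} \<psi> (trac \<psi>)"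
  using rayleigh_solution_iff_state[of "{..<0}" \<psi>] by (simp add: jost_solution_def)

text \<open>The inequality is strict because the derivative at \<open>Y\<close> needs the
  exponential formula on a whole neighbourhood.\<close>

lemma jost_traction:
  assumes J: "jost_solution \<omega> H lam mu \<xi> v \<kappa> \<psi>" and Y: "Y < - H"
  shows "trac \<psi> Y = exp (\<kappa> * of_real Y) *s plane_wave_traction Y v \<kappa>"
proof -
  have \<psi>: "\<psi> Z = exp (\<kappa> * of_real Z) *s v" if "Z \<le> - H" for Z
    using J that by (auto simp: jost_solution_def)
  have e: "((\<lambda>Z. exp (\<kappa> * of_real Z) * c) has_vector_derivative \<kappa> * exp (\<kappa> * of_real Y) * c) (at Y)" for c
    by (rule has_vector_derivative_real_field, auto intro!: derivative_eq_intros)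
  have "((\<lambda>Z. exp (\<kappa> * of_real Z) *s v) has_vector_derivative (\<kappa> * exp (\<kappa> * of_real Y)) *s v) (at Y)"
    by (simp add: has_vector_derivative_vec2_iff e)
  then have "(\<psi> has_vector_derivative (\<kappa> * exp (\<kappa> * of_real Y)) *s v) (at Y)"
    by (rule has_vector_derivative_transform_within_open[of _ _ _ "{..<-H}"]) (use Y \<psi> in auto)
  then have "ddz \<psi> Y = (\<kappa> * exp (\<kappa> * of_real Y)) *s v"
    by (rule vector_derivative_at)
  then show ?thesis
    using Y \<psi>[of Y]
    by (simp add: traction_def coefficient_matrix_mult plane_wave_traction_def vec2_eq_iff algebra_simps)
qed

text \<open>Constancy moves the evaluation to the homogeneous region, where both solutions are
  explicit.\<close>

lemma jost_wronskian:
  assumes J: "jost_solution \<omega> H lam mu \<xi> v \<kappa> \<psi>" "jost_solution \<omega> H lam mu \<xi> v' \<kappa>' \<psi>'"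
    and "Y < - H" "Y < 0" "Z < 0"
  shows "wronskian (\<psi> Z) (trac \<psi> Z) (\<psi>' Z) (trac \<psi>' Z) =
     exp ((\<kappa> + \<kappa>') * of_real Y) *
       wronskian v (plane_wave_traction Y v \<kappa>) v' (plane_wave_traction Y v' \<kappa>')"
proof -
  have "wronskian (\<psi> Z) (trac \<psi> Z) (\<psi>' Z) (trac \<psi>' Z) = wronskian (\<psi> Y) (trac \<psi> Y) (\<psi>' Y) (trac \<psi>' Y)"
    by (rule wronskian_constant[OF jost_state[OF J(1)] jost_state[OF J(2)]]) (use assms(4,5) in auto)
  moreover have "\<psi> Y = exp (\<kappa> * of_real Y) *s v" "\<psi>' Y = exp (\<kappa>' * of_real Y) *s v'"
    using J \<open>Y < - H\<close> by (auto simp: jost_solution_def)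
  ultimately show ?thesis
    using jost_traction[OF J(1) \<open>Y < - H\<close>] jost_traction[OF J(2) \<open>Y < - H\<close>]
    by (simp add: wronskian_simps distrib_right exp_add)
qed

end

section \<open>The Jost solutions as a symplectic basis, and the formula for the kernel\<close>

theorem theorem6p1:
  fixes \<omega> H lam0 mu0 \<alpha>0 \<beta>0 :: real
    and lam mu :: "real \<Rightarrow> real"
    and \<xi> qP qS R1 R2 R1t R2t :: complex
    and psiPp psiPm psiSp psiSm gP gS :: "real \<Rightarrow> complex^2"
  assumes "\<omega> > 0" and "H > 0"
    and "C_k_on 3 {..0} lam" and "C_k_on 3 {..0} mu"
    and "\<alpha>0 > 0" and "\<And>Z. Z \<le> 0 \<Longrightarrow> mu Z \<ge> \<alpha>0"
    and "\<beta>0 > 0" and "\<And>Z. Z \<le> 0 \<Longrightarrow> 2 * mu Z + 3 * lam Z \<ge> \<beta>0"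
    and "\<And>Z. Z < -H \<Longrightarrow> lam Z = lam0" and "\<And>Z. Z < -H \<Longrightarrow> mu Z = mu0"
    and "physical_sheet \<omega> lam0 mu0 \<xi> qP qS"
    and "jost_solution \<omega> H lam mu \<xi> (vector [-\<xi>, \<i> * qP]) (\<i> * qP) psiPp"
    and "jost_solution \<omega> H lam mu \<xi> (vector [-\<xi>, -\<i> * qP]) (-\<i> * qP) psiPm"
    and "jost_solution \<omega> H lam mu \<xi> (vector [\<i> * qS, -\<xi>]) (\<i> * qS) psiSp"
    and "jost_solution \<omega> H lam mu \<xi> (vector [-\<i> * qS, -\<xi>]) (-\<i> * qS) psiSm"
    and "rayleigh_det lam mu \<xi> psiPm psiSm \<noteq> 0"
    and "gP = (\<lambda>Z. psiPp Z + R2 *s psiPm Z - (qP * R1) *s psiSm Z)"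
    and "gS = (\<lambda>Z. psiSp Z + (qS * R1t) *s psiPm Z + R2t *s psiSm Z)"
    and "traction_free lam mu \<xi> gP" and "traction_free lam mu \<xi> gS"
  shows "(\<exists>G. greens_function \<omega> lam mu \<xi> G) \<and>
         (\<forall>G. greens_function \<omega> lam mu \<xi> G \<longrightarrow>
           (\<forall>Z Z'.
             (Z < Z' \<and> Z' < 0 \<longrightarrow>
                G Z Z' = cscale (1 / (2 * \<i> * of_real (\<omega>\<^sup>2)))
                  (cscale (1 / qP) (outer_prod (psiPm Z) (gP Z'))
                   + cscale (1 / qS) (outer_prod (psiSm Z) (gS Z')))) \<and>
             (Z' < Z \<and> Z < 0 \<longrightarrow>
                G Z Z' = cscale (1 / (2 * \<i> * of_real (\<omega>\<^sup>2)))
                  (cscale (1 / qP) (outer_prod (gP Z) (psiPm Z'))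
                   + cscale (1 / qS) (outer_prod (gS Z) (psiSm Z'))))))"
proof -
  note Pp = assms(12) and Pm = assms(13) and Sp = assms(14) and Sm = assms(15)
  \<comment> \<open>\<open>3 (lam + 2 mu) = (2 mu + 3 lam) + 4 mu\<close> is a sum of positive
    terms.\<close>
  have sigma: "lam Z + 2 * mu Z > 0" if "Z \<le> 0" for Z
    using assms(5,7) assms(6)[OF that] assms(8)[OF that] by simp
  interpret elastic_half_line \<omega> lam mu \<xi>
    using C_k_on_imp_differentiable[OF assms(3)] C_k_on_imp_differentiable[OF assms(4)] assms(5,6) sigma
    by unfold_locales (auto intro: less_le_trans)
  define Y where "Y = - H - 1"
  have Y: "Y < - H" "Y < 0" using \<open>H > 0\<close> by (simp_all add: Y_def)
  have coef: "lam Y = lam0" "mu Y = mu0" using assms(9,10) Y by auto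
  have pos0: "mu0 > 0" "lam0 + 2 * mu0 > 0"
    using mu_pos[of Y] sigma_pos[of Y] Y coef by auto
  note sheet = assms(11)
  have Im: "Im qP > 0" "Im qS > 0" using sheet by (auto simp: physical_sheet_def)
  then have q0: "qP \<noteq> 0" "qS \<noteq> 0" by auto
  define m where "m = complex_of_real mu0"
  define l where "l = complex_of_real lam0"
  have "m \<noteq> 0" "l + 2 * m \<noteq> 0"
    using coefficients_nonzero[of Y] Y coef by (auto simp: m_def l_def)
  then have q2: "qP * qP * (l + 2 * m) = of_real (\<omega>\<^sup>2) - \<xi> * \<xi> * (l + 2 * m)"
    "qS * qS * m = of_real (\<omega>\<^sup>2) - \<xi> * \<xi> * m"
    using sheet by (simp_all add: physical_sheet_def power2_eq_square[symmetric] m_def l_def field_simps)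
  \<comment> \<open>By the two dispersion relations the normal traction of a P wave and the shear
    traction of an S wave both have amplitude \<open>- E\<close>.\<close>
  define E where "E = of_real (\<omega>\<^sup>2) - 2 * m * (\<xi> * \<xi>)"
  have E: "E = qP * qP * (l + 2 * m) + \<xi> * \<xi> * l" "E = qS * qS * m - \<xi> * \<xi> * m"
    unfolding E_def using q2 by (simp_all add: algebra_simps)
  have waves:
    "plane_wave_traction Y (vector [-\<xi>, \<i> * qP]) (\<i> * qP) = vector [- 2 * \<i> * m * qP * \<xi>, - E]"
    "plane_wave_traction Y (vector [-\<xi>, -\<i> * qP]) (-\<i> * qP) = vector [2 * \<i> * m * qP * \<xi>, - E]"
    by (simp_all add: plane_wave_traction_def vec2_eq_iff coef E(1) m_def l_def algebra_simps)
  have waves':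
    "plane_wave_traction Y (vector [\<i> * qS, -\<xi>]) (\<i> * qS) = vector [- E, - 2 * \<i> * m * qS * \<xi>]"
    "plane_wave_traction Y (vector [-\<i> * qS, -\<xi>]) (-\<i> * qS) = vector [- E, 2 * \<i> * m * qS * \<xi>]"
    by (simp_all add: plane_wave_traction_def vec2_eq_iff coef E(2) m_def l_def algebra_simps)
  note W = jost_wronskian[OF _ _ Y]
  define w where "w \<phi> \<psi> Z = wronskian (\<phi> Z) (trac \<phi> Z) (\<psi> Z) (trac \<psi> Z)" for \<phi> \<psi> Z
  \<comment> \<open>Opposite exponents cancel, and
    \<open>E + 2 * m * \<xi>\<^sup>2 = \<omega>\<^sup>2\<close> removes the Lame constants from the
    result.\<close>
  have PmPp: "w psiPm psiPp Z = 2 * \<i> * of_real (\<omega>\<^sup>2) * qP" if "Z < 0" for Z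
    using W[OF Pm Pp that] unfolding w_def waves
    by (simp add: wronskian_def E_def algebra_simps)
  have SmSp: "w psiSm psiSp Z = 2 * \<i> * of_real (\<omega>\<^sup>2) * qS" if "Z < 0" for Z
    using W[OF Sm Sp that] unfolding w_def waves'
    by (simp add: wronskian_def E_def algebra_simps)
  \<comment> \<open>The exponentials need not cancel here: the pairing of a P amplitude with an S
    amplitude is already zero.\<close>
  have cross: "w psiPm psiSm Z = 0" "w psiPm psiSp Z = 0" "w psiSm psiPp Z = 0" if "Z < 0" for Z
    using W[OF Pm Sm that] W[OF Pm Sp that] W[OF Sm Pp that] unfolding w_def waves waves'
    by (simp_all add: wronskian_def[of "vector _"] algebra_simps)
  define tP where "tP Z = trac psiPp Z + R2 *s trac psiPm Z + (- (qP * R1)) *s trac psiSm Z" for Z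
  define tS where "tS Z = trac psiSp Z + (qS * R1t) *s trac psiPm Z + R2t *s trac psiSm Z" for Z
  have gP: "gP Z = psiPp Z + R2 *s psiPm Z + (- (qP * R1)) *s psiSm Z" for Z
    by (simp add: assms(17) vec2_eq_iff)
  have gS: "gS Z = psiSp Z + (qS * R1t) *s psiPm Z + R2t *s psiSm Z" for Z
    by (simp add: assms(18))
  have decay: "(psiPm \<longlongrightarrow> 0) at_bot" "(psiSm \<longlongrightarrow> 0) at_bot"
  proof -
    have "(\<psi> \<longlongrightarrow> 0) at_bot" if "jost_solution \<omega> H lam mu \<xi> v (- \<i> * q) \<psi>" "Im q > 0" for \<psi> v q
    proof -
      have "((\<lambda>Z. exp (- \<i> * q * of_real Z) *s v) \<longlongrightarrow> 0) at_bot"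
        using exp_ii_tendsto_0[OF that(2)] by (simp add: tendsto_vec2_iff tendsto_mult_left_zero)
      then show ?thesis
        using eventually_gt_at_bot[of "-H"]
        by (rule Lim_transform_eventually[OF _ eventually_mono]) (use that(1) in \<open>simp add: jost_solution_def\<close>)
    qed
    then show "(psiPm \<longlongrightarrow> 0) at_bot" "(psiSm \<longlongrightarrow> 0) at_bot"
      using Pm Sm Im by blast+
  qed
  interpret elastic_green \<omega> lam mu \<xi> psiPm psiSm gP gS "trac psiPm" "trac psiSm" tP tS
      "2 * \<i> * of_real (\<omega>\<^sup>2) * qP" "2 * \<i> * of_real (\<omega>\<^sup>2) * qS"
  proof
    show "state {..<0} gP tP" "state {..<0} gS tS"
      unfolding tP_def[abs_def] tS_def[abs_def] gP[abs_def] gS[abs_def]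
      by (intro state_add state_smult jost_state[OF Pp] jost_state[OF Pm] jost_state[OF Sp] jost_state[OF Sm])+
    fix Z :: real assume Z: "Z < 0"
    have anti: "w psiSm psiPm Z = 0"
      using cross(1)[OF Z] wronskian_anticommute[of "psiSm Z" "trac psiSm Z" "psiPm Z" "trac psiPm Z"]
      by (simp add: w_def)
    show "wronskian (psiPm Z) (trac psiPm Z) (psiSm Z) (trac psiSm Z) = 0"
      using cross(1)[OF Z] by (simp add: w_def)
    \<comment> \<open>The reflection coefficients drop out: they multiply \<open>psiPm\<close> and
      \<open>psiSm\<close>, which pair to zero with themselves and each other.\<close>
    show "wronskian (psiPm Z) (trac psiPm Z) (gS Z) (tS Z) = 0"
      "wronskian (psiSm Z) (trac psiSm Z) (gP Z) (tP Z) = 0"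
      "wronskian (psiPm Z) (trac psiPm Z) (gP Z) (tP Z) = 2 * \<i> * of_real (\<omega>\<^sup>2) * qP"
      "wronskian (psiSm Z) (trac psiSm Z) (gS Z) (tS Z) = 2 * \<i> * of_real (\<omega>\<^sup>2) * qS"
      using cross[OF Z] anti PmPp[OF Z] SmSp[OF Z]
      unfolding w_def gP gS tP_def tS_def wronskian_simps by simp_all
  next
    fix c d assume "((\<lambda>Z. c *s gP Z + d *s gS Z) \<longlongrightarrow> 0) at_bot"
    \<comment> \<open>The reflected parts decay, so subtracting them leaves a decaying combination
      of the two growing waves.\<close>
    then have "((\<lambda>Z. c *s gP Z + d *s gS Z
        - ((c * R2 + d * (qS * R1t)) *s psiPm Z + (d * R2t - c * (qP * R1)) *s psiSm Z))
      \<longlongrightarrow> 0 - ((c * R2 + d * (qS * R1t)) *s 0 + (d * R2t - c * (qP * R1)) *s 0)) at_bot"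
      by (intro tendsto_diff tendsto_add tendsto_smult decay)
    moreover have "c *s gP Z + d *s gS Z
        - ((c * R2 + d * (qS * R1t)) *s psiPm Z + (d * R2t - c * (qP * R1)) *s psiSm Z)
        = c *s psiPp Z + d *s psiSp Z" for Z
      by (simp add: gP gS vec2_eq_iff algebra_simps)
    ultimately have "((\<lambda>Z. c *s psiPp Z + d *s psiSp Z) \<longlongrightarrow> 0) at_bot" by simp
    then have "((\<lambda>Z. vector [- \<xi> * c * exp (\<i> * qP * of_real Z) + \<i> * qS * d * exp (\<i> * qS * of_real Z),
        \<i> * qP * c * exp (\<i> * qP * of_real Z) - \<xi> * d * exp (\<i> * qS * of_real Z)] :: complex^2) \<longlongrightarrow> 0) at_bot"
      using eventually_gt_at_bot[of "-H"]
      by (rule Lim_transform_eventually[OF _ eventually_mono])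
         (use Pp Sp in \<open>simp add: jost_solution_def vec2_eq_iff algebra_simps\<close>)
    then have
      1: "((\<lambda>Z. - \<xi> * c * exp (\<i> * qP * of_real Z) + \<i> * qS * d * exp (\<i> * qS * of_real Z)) \<longlongrightarrow> 0) (at_bot :: real filter)" and
      2: "((\<lambda>Z. \<i> * qP * c * exp (\<i> * qP * of_real Z) - \<xi> * d * exp (\<i> * qS * of_real Z)) \<longlongrightarrow> 0) (at_bot :: real filter)"
      by (simp_all add: tendsto_vec2_iff)
    \<comment> \<open>The multipliers come from the adjugate of the matrix of polarisations: one
      exponential drops out, the other is multiplied by the determinant
      \<open>\<xi>\<^sup>2 + qP * qS\<close>.\<close>
    have "((\<lambda>Z. (c * (\<xi>\<^sup>2 + qP * qS)) * exp (\<i> * qP * of_real Z)) \<longlongrightarrow> 0) (at_bot :: real filter)"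
      using tendsto_add[OF tendsto_mult[OF tendsto_const[of "- \<xi>"] 1] tendsto_mult[OF tendsto_const[of "- \<i> * qS"] 2]]
      by (simp add: algebra_simps power2_eq_square)
    then have "c * (\<xi>\<^sup>2 + qP * qS) = 0"
      by (rule growing_exp_tendsto_0D[OF Im(1)])
    moreover have "((\<lambda>Z. (d * (\<xi>\<^sup>2 + qP * qS)) * exp (\<i> * qS * of_real Z)) \<longlongrightarrow> 0) (at_bot :: real filter)"
      using tendsto_add[OF tendsto_mult[OF tendsto_const[of "- \<i> * qP"] 1] tendsto_mult[OF tendsto_const[of "- \<xi>"] 2]]
      by (simp add: algebra_simps power2_eq_square)
    then have "d * (\<xi>\<^sup>2 + qP * qS) = 0"
      by (rule growing_exp_tendsto_0D[OF Im(2)])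
    ultimately show "c = 0 \<and> d = 0"
      using physical_sheet_det_nonzero[OF sheet assms(1) pos0] by simp
  qed (use q0 assms(1,19,20) decay jost_state[OF Pm] jost_state[OF Sm] in simp_all)
  have eq: "M = cscale (1 / (2 * \<i> * of_real (\<omega>\<^sup>2)))
       (cscale (1 / qP) (outer_prod x y) + cscale (1 / qS) (outer_prod x' y'))"
    if "\<And>j. column j M = (y $ j / (2 * \<i> * of_real (\<omega>\<^sup>2) * qP)) *s x
        + (y' $ j / (2 * \<i> * of_real (\<omega>\<^sup>2) * qS)) *s x'" for M x y x' y'
    using that by (simp add: column_def vec_eq_iff cscale_def outer_prod_def distrib_left mult.commute)
  show ?thesis
  proof (intro conjI exI allI impI)
    show "greens_function \<omega> lam mu \<xi> kernel" by (rule greens_function_kernel)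
  next
    fix G and Z Z' :: real
    assume G: "greens_function \<omega> lam mu \<xi> G" and Z: "Z < Z' \<and> Z' < 0"
    show "G Z Z' = cscale (1 / (2 * \<i> * of_real (\<omega>\<^sup>2)))
        (cscale (1 / qP) (outer_prod (psiPm Z) (gP Z')) + cscale (1 / qS) (outer_prod (psiSm Z) (gS Z')))"
      by (rule eq) (use Z in \<open>simp only: greens_function_unique(1)[OF G] lcol_def\<close>)
  next
    fix G and Z Z' :: real
    assume G: "greens_function \<omega> lam mu \<xi> G" and Z: "Z' < Z \<and> Z < 0"
    then have "Z' < 0" by simp
    with Z show "G Z Z' = cscale (1 / (2 * \<i> * of_real (\<omega>\<^sup>2)))
        (cscale (1 / qP) (outer_prod (gP Z) (psiPm Z')) + cscale (1 / qS) (outer_prod (gS Z) (psiSm Z')))"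
      by (intro eq) (simp only: greens_function_unique(2)[OF G] rcol_def)
  qed
qed

end
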